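(* Let $G$ be the Heisenberg group of dimension $2n+1$. For any non-trivial connected closed subgroup $H$ of $G$, the action of $G$ on $G^{\mathbb{C}}/H^{\mathbb{C}}$ by left translation is strongly visible.
   Context: Let $n\ge 1$. The Heisenberg Lie algebra $\mathfrak{g}$ is the real Lie algebra with basis $X_1,\dots,X_n,Y_1,\dots,Y_n,Z$ and brackets $[X_i,Y_j]=\delta_{ij}Z$, $[X_i,X_j]=[Y_i,Y_j]=[X_i,Z]=[Y_j,Z]=0$. The Heisenberg group $G=\mathbf{H}_n=\exp\mathfrak{g}$ is the connected and simply connected Lie group with Lie algebra $\mathfrak{g}$. A connected closed subgroup $H$ is $H=\exp\mathfrak{h}$ for a subalgebra $\mathfrak{h}$; non-trivial means $H\neq\{e\}$ and $H\neq G$. Let $\mathfrak{g}^{\mathbb{C}},\mathfrak{h}^{\mathbb{C}}$ be the complexifications, $G^{\mathbb{C}}=\exp\mathfrak{g}^{\mathbb{C}}$ the connected, simply connected complex Lie group with Lie algebra $\mathfrak{g}^{\mathbb{C}}$, and $H^{\mathbb{C}}=\exp\mathfrak{h}^{\mathbb{C}}$. Then $G^{\mathbb{C}}/H^{\mathbb{C}}$ is a connected complex manifold on which $G$ acts holomorphically by left translation. Strong visibility: a holomorphic action of a Lie group $L$ on a connected complex manifold $D$ is called strongly visible if there exist a real submanifold $S$ in $D$ and an anti-holomorphic diffeomorphism $\sigma$ of $D$ such that: (V.0) $D':=L\cdot S$ is a non-empty open set in $D$; (S.1) $\sigma|_S=\operatorname{id}_S$; (S.2) $\sigma$ preserves each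 $L$-orbit in $D'$. *)

theory Defs
  imports "HOL-Analysis.Analysis" "HOL-Algebra.Left_Coset" "HOL-Algebra.Group_Action"
begin

section \<open>Smooth, holomorphic and anti-holomorphic maps\<close>

text \<open>
  The predicates below are meant for open sets \<open>S\<close>; all manifold notions apply them to open
  subsets of the model space only.
\<close>

primrec Ck_on :: "nat \<Rightarrow> ('a::euclidean_space \<Rightarrow> 'b::euclidean_space) \<Rightarrow> 'a set \<Rightarrow> bool" where
  "Ck_on 0 f S \<longleftrightarrow> continuous_on S f"
| "Ck_on (Suc k) f S \<longleftrightarrow>
     (\<forall>x\<in>S. f differentiable (at x)) \<and> (\<forall>v. Ck_on k (\<lambda>x. frechet_derivative f (at x) v) S)"

definition smooth :: "('a::euclidean_space \<Rightarrow> 'b::euclidean_space) \<Rightarrow> 'a set \<Rightarrow> bool" where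
  "smooth f S \<longleftrightarrow> (\<forall>k. Ck_on k f S)"

definition holomorphic_vec :: "(complex^'a \<Rightarrow> complex^'b) \<Rightarrow> (complex^'a) set \<Rightarrow> bool" where
  "holomorphic_vec f S \<longleftrightarrow>
     (\<forall>x\<in>S. \<exists>f'. (f has_derivative f') (at x) \<and> (\<forall>c v. f' (c *s v) = c *s f' v))"

definition antiholomorphic_vec :: "(complex^'a \<Rightarrow> complex^'b) \<Rightarrow> (complex^'a) set \<Rightarrow> bool" where
  "antiholomorphic_vec f S \<longleftrightarrow>
     (\<forall>x\<in>S. \<exists>f'. (f has_derivative f') (at x) \<and> (\<forall>c v. f' (c *s v) = cnj c *s f' v))"

definition smooth_diffeo :: "'a::euclidean_space set \<Rightarrow> 'a set \<Rightarrow> ('a \<Rightarrow> 'a) \<Rightarrow> bool" where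
  "smooth_diffeo W W' \<Phi> \<longleftrightarrow> open W \<and> open W' \<and> bij_betw \<Phi> W W' \<and>
     smooth \<Phi> W \<and> smooth (inv_into W \<Phi>) W'"


section \<open>Manifolds and their maps\<close>

text \<open>
  A chart is a pair of its domain and its coordinate map. Atlases need not be maximal.
\<close>

record ('p, 'e) charted_space =
  top_of :: "'p topology"
  atlas_of :: "('p set \<times> ('p \<Rightarrow> 'e)) set"

definition second_countable_space :: "'p topology \<Rightarrow> bool" where
  "second_countable_space X \<longleftrightarrow> (\<exists>\<B>. countable \<B> \<and> (\<forall>B\<in>\<B>. openin X B) \<and>
     (\<forall>U x. openin X U \<and> x \<in> U \<longrightarrow> (\<exists>B\<in>\<B>. x \<in> B \<and> B \<subseteq> U)))"

definition is_chart :: "'p topology \<Rightarrow> 'p set \<Rightarrow> ('p \<Rightarrow> 'e::topological_space) \<Rightarrow> bool" where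
  "is_chart X U \<phi> \<longleftrightarrow> openin X U \<and> open (\<phi> ` U) \<and>
     homeomorphic_map (subtopology X U) (top_of_set (\<phi> ` U)) \<phi>"

text \<open>
  The parameter \<open>P\<close> is the class of maps between open subsets of the model space that the
  transition functions have to belong to.
\<close>

definition manifold_wrt ::
    "(('e \<Rightarrow> 'e) \<Rightarrow> 'e set \<Rightarrow> bool) \<Rightarrow> ('p, 'e::topological_space) charted_space \<Rightarrow> bool" where
  "manifold_wrt P M \<longleftrightarrow>
     Hausdorff_space (top_of M) \<and> second_countable_space (top_of M) \<and>
     topspace (top_of M) = (\<Union>(U, \<phi>)\<in>atlas_of M. U) \<and>
     (\<forall>(U, \<phi>)\<in>atlas_of M. is_chart (top_of M) U \<phi>) \<and>
     (\<forall>(U, \<phi>)\<in>atlas_of M. \<forall>(V, \<psi>)\<in>atlas_of M. P (\<psi> \<circ> inv_into U \<phi>) (\<phi> ` (U \<inter> V)))"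

abbreviation smooth_manifold :: "('p, 'e::euclidean_space) charted_space \<Rightarrow> bool" where
  "smooth_manifold \<equiv> manifold_wrt smooth"

abbreviation complex_manifold :: "('p, complex^'m) charted_space \<Rightarrow> bool" where
  "complex_manifold \<equiv> manifold_wrt holomorphic_vec"

text \<open>
  A map is of class \<open>P\<close> if around every point it is so in suitable charts. For the classes used
  here this includes continuity and does not depend on the choice of charts.
\<close>

definition manifold_map ::
    "(('e \<Rightarrow> 'f) \<Rightarrow> 'e set \<Rightarrow> bool) \<Rightarrow> ('p, 'e::topological_space) charted_space \<Rightarrow>
     ('q, 'f::topological_space) charted_space \<Rightarrow> ('p \<Rightarrow> 'q) \<Rightarrow> bool" where
  "manifold_map P M N f \<longleftrightarrow>
     (\<forall>p\<in>topspace (top_of M). \<exists>(U, \<phi>)\<in>atlas_of M. \<exists>(V, \<psi>)\<in>atlas_of N. \<exists>W.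
        p \<in> U \<and> open W \<and> \<phi> p \<in> W \<and> W \<subseteq> \<phi> ` U \<and>
        f ` inv_into U \<phi> ` W \<subseteq> V \<and> P (\<psi> \<circ> f \<circ> inv_into U \<phi>) W)"

definition prod_manifold ::
    "('p, 'e) charted_space \<Rightarrow> ('q, 'f) charted_space \<Rightarrow> ('p \<times> 'q, 'e \<times> 'f) charted_space" where
  "prod_manifold M N =
     \<lparr>top_of = prod_topology (top_of M) (top_of N),
      atlas_of = {(U \<times> V, map_prod \<phi> \<psi>) | U \<phi> V \<psi>. (U, \<phi>) \<in> atlas_of M \<and> (V, \<psi>) \<in> atlas_of N}\<rparr>"

definition model_manifold :: "('e::topological_space, 'e) charted_space" where
  "model_manifold = \<lparr>top_of = euclidean, atlas_of = {(UNIV, id)}\<rparr>"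

text \<open>
  Real (embedded) submanifolds, by slice charts: near each of its points, \<open>S\<close> is given in smooth
  real coordinates by a linear subspace of a fixed real dimension \<open>d\<close>.
\<close>

definition real_submanifold :: "('p, 'e::euclidean_space) charted_space \<Rightarrow> 'p set \<Rightarrow> bool" where
  "real_submanifold M S \<longleftrightarrow> S \<subseteq> topspace (top_of M) \<and>
     (\<exists>d. \<forall>p\<in>S. \<exists>(U, \<phi>)\<in>atlas_of M. \<exists>W W' \<Phi> T.
        p \<in> U \<and> \<phi> p \<in> W \<and> W \<subseteq> \<phi> ` U \<and> smooth_diffeo W W' \<Phi> \<and>
        subspace T \<and> dim T = d \<and> \<Phi> ` (\<phi> ` (S \<inter> U) \<inter> W) = T \<inter> W')"

definition antiholomorphic_diffeo :: "('p, complex^'m) charted_space \<Rightarrow> ('p \<Rightarrow> 'p) \<Rightarrow> bool" where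
  "antiholomorphic_diffeo M \<sigma> \<longleftrightarrow>
     bij_betw \<sigma> (topspace (top_of M)) (topspace (top_of M)) \<and>
     manifold_map antiholomorphic_vec M M \<sigma> \<and>
     manifold_map antiholomorphic_vec M M (inv_into (topspace (top_of M)) \<sigma>)"


section \<open>Strongly visible actions\<close>

definition lie_group :: "'g monoid \<Rightarrow> ('g, 'l::euclidean_space) charted_space \<Rightarrow> bool" where
  "lie_group L ML \<longleftrightarrow> group L \<and> smooth_manifold ML \<and> topspace (top_of ML) = carrier L \<and>
     manifold_map smooth (prod_manifold ML ML) ML (\<lambda>(g, h). g \<otimes>\<^bsub>L\<^esub> h) \<and>
     manifold_map smooth ML ML (\<lambda>g. inv\<^bsub>L\<^esub> g)"

definition holomorphic_action ::
    "'g monoid \<Rightarrow> ('g, 'l::euclidean_space) charted_space \<Rightarrow> ('p, complex^'m) charted_space \<Rightarrow>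
     ('g \<Rightarrow> 'p \<Rightarrow> 'p) \<Rightarrow> bool" where
  "holomorphic_action L ML D act \<longleftrightarrow> lie_group L ML \<and> complex_manifold D \<and>
     group_action L (topspace (top_of D)) act \<and>
     manifold_map smooth (prod_manifold ML D) D (\<lambda>(g, x). act g x) \<and>
     (\<forall>g\<in>carrier L. manifold_map holomorphic_vec D D (act g))"

definition strongly_visible ::
    "'g monoid \<Rightarrow> ('g, 'l::euclidean_space) charted_space \<Rightarrow> ('p, complex^'m) charted_space \<Rightarrow>
     ('g \<Rightarrow> 'p \<Rightarrow> 'p) \<Rightarrow> bool" where
  "strongly_visible L ML D act \<longleftrightarrow>
     holomorphic_action L ML D act \<and> connected_space (top_of D) \<and>
     (\<exists>S \<sigma>. real_submanifold D S \<and> antiholomorphic_diffeo D \<sigma> \<and>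
        (let D' = (\<Union>s\<in>S. orbit L act s) in
          D' \<noteq> {} \<and> openin (top_of D) D' \<and>
          (\<forall>s\<in>S. \<sigma> s = s) \<and>
          (\<forall>x\<in>D'. \<sigma> ` orbit L act x = orbit L act x)))"


section \<open>The Heisenberg group and its complexification\<close>

text \<open>
  Coordinates with respect to the basis \<open>X\<^sub>i\<close>, \<open>Y\<^sub>i\<close>, \<open>Z\<close>; the number \<open>n\<close> is \<open>CARD('n)\<close>.
\<close>

datatype 'n heis_index = IX 'n | IY 'n | IZ

instance heis_index :: (finite) finite
proof
  have "x \<in> range IX \<union> range IY \<union> {IZ}" for x :: "'a heis_index"
    by (cases x) auto
  then have "(UNIV :: 'a heis_index set) = range IX \<union> range IY \<union> {IZ}"
    by blast
  then show "finite (UNIV :: 'a heis_index set)"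
    by (metis finite_Un finite_imageI finite finite.emptyI finite.insertI)
qed

definition heis_bracket ::
    "'a::field^('n::finite heis_index) \<Rightarrow> 'a^('n heis_index) \<Rightarrow> 'a^('n heis_index)" where
  "heis_bracket v w = (\<Sum>i\<in>UNIV. v $ IX i * w $ IY i - v $ IY i * w $ IX i) *s axis IZ 1"

text \<open>
  The connected and simply connected group of this two-step nilpotent Lie algebra, over \<open>\<real>\<close> or
  \<open>\<complex>\<close>, in exponential coordinates: a group element is identified with its logarithm, so that the
  exponential map is the identity, and the product is given by the Baker-Campbell-Hausdorff formula.
\<close>

definition heisenberg :: "('a::field^('n::finite heis_index)) monoid" where
  "heisenberg = \<lparr>carrier = UNIV, mult = (\<lambda>v w. v + w + (1/2) *s heis_bracket v w), one = 0\<rparr>"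

abbreviation heisenberg_real :: "(real^('n::finite heis_index)) monoid" where
  "heisenberg_real \<equiv> heisenberg"

abbreviation heisenberg_complex :: "(complex^('n::finite heis_index)) monoid" where
  "heisenberg_complex \<equiv> heisenberg"

lemma heis_bracket_basis:
  fixes i j :: "'n::finite"
  shows "heis_bracket (axis (IX i) 1) (axis (IY j) (1::'a::field)) = (if i = j then axis IZ 1 else 0)"
    and "heis_bracket (axis (IX i) 1) (axis (IX j) (1::'a)) = 0"
    and "heis_bracket (axis (IY i) 1) (axis (IY j) (1::'a)) = 0"
    and "heis_bracket v (axis IZ (1::'a)) = 0"
    and "heis_bracket w v = - heis_bracket v (w :: 'a^('n heis_index))"
  by (auto simp: heis_bracket_def axis_def vec_eq_iff if_distrib[where f="\<lambda>x. x * _"]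
      if_distrib[where f="\<lambda>x. _ * x"] sum.delta' mult.commute sum_subtractf cong: if_cong)

lemma group_heisenberg: "group (heisenberg :: ('a::field^('n::finite heis_index)) monoid)"
proof (rule groupI)
  fix x :: "'a^('n heis_index)"
  have "heis_bracket (- x) x = 0"
    by (simp add: heis_bracket_def)
  then show "\<exists>y\<in>carrier heisenberg. y \<otimes>\<^bsub>heisenberg\<^esub> x = \<one>\<^bsub>heisenberg\<^esub>"
    by (intro bexI[of _ "- x"]) (auto simp: heisenberg_def)
qed (auto simp: heisenberg_def heis_bracket_def vec_eq_iff axis_def sum.distrib algebra_simps
      sum_subtractf add_divide_distrib diff_divide_distrib)

lemma heisenberg_one_parameter:
  "(s *s x) \<otimes>\<^bsub>heisenberg\<^esub> (t *s x) = (s + t) *s (x :: 'a::field^('n::finite heis_index))"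
  by (simp add: heisenberg_def heis_bracket_def vec_eq_iff algebra_simps)

text \<open>The Lie algebra of a closed subgroup \<open>H\<close>: all \<open>x\<close> with \<open>exp (t x) \<in> H\<close> for every real \<open>t\<close>.\<close>

definition lie_algebra_of :: "(real^('n::finite heis_index)) set \<Rightarrow> (real^('n heis_index)) set" where
  "lie_algebra_of H = {x. \<forall>t. t *s x \<in> H}"

definition complexify :: "real^'k \<Rightarrow> complex^'k" where
  "complexify x = (\<chi> i. complex_of_real (x $ i))"

text \<open>\<open>H\<^sup>\<complex> = exp (\<hh> + \<i> \<hh>)\<close> for the Lie algebra \<open>\<hh>\<close> of \<open>H\<close>.\<close>

definition complexified_subgroup ::
    "(real^('n::finite heis_index)) set \<Rightarrow> (complex^('n heis_index)) set" where
  "complexified_subgroup H =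
     {complexify x + \<i> *s complexify y | x y. x \<in> lie_algebra_of H \<and> y \<in> lie_algebra_of H}"


section \<open>Homogeneous spaces\<close>

text \<open>
  The complex manifold \<open>K/H\<close> for a complex Lie group \<open>K\<close> with underlying manifold \<open>\<complex>\<^sup>k\<close>. It carries
  the quotient topology and the complex structure that makes the projection a holomorphic
  submersion: a chart is a coordinate map that is holomorphic after composition with the
  projection and whose inverse locally lifts to holomorphic maps into \<open>K\<close>. The type \<open>'m\<close> has to be
  chosen with \<open>CARD('m) = dim K - dim H\<close>, since there are no charts otherwise.
\<close>

definition quotient_topology :: "(complex^'k) monoid \<Rightarrow> (complex^'k) set \<Rightarrow> (complex^'k) set topology" where
  "quotient_topology K H =
     topology (\<lambda>U. U \<subseteq> lcosets\<^bsub>K\<^esub> H \<and> open {g. g <#\<^bsub>K\<^esub> H \<in> U})"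

definition homogeneous_space ::
    "(complex^'k) monoid \<Rightarrow> (complex^'k) set \<Rightarrow> ((complex^'k) set, complex^'m) charted_space" where
  "homogeneous_space K H =
     \<lparr>top_of = quotient_topology K H,
      atlas_of = {(U, \<phi>). openin (quotient_topology K H) U \<and> inj_on \<phi> U \<and> open (\<phi> ` U) \<and>
        holomorphic_vec (\<lambda>g. \<phi> (g <#\<^bsub>K\<^esub> H)) {g. g <#\<^bsub>K\<^esub> H \<in> U} \<and>
        (\<forall>z\<in>\<phi> ` U. \<exists>N s. open N \<and> z \<in> N \<and> N \<subseteq> \<phi> ` U \<and> holomorphic_vec s N \<and>
           (\<forall>w\<in>N. s w <#\<^bsub>K\<^esub> H \<in> U \<and> \<phi> (s w <#\<^bsub>K\<^esub> H) = w))}\<rparr>"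

definition left_translation ::
    "(real^('n::finite heis_index)) set \<Rightarrow>
     real^('n heis_index) \<Rightarrow> (complex^('n heis_index)) set \<Rightarrow> (complex^('n heis_index)) set" where
  "left_translation H g = (\<lambda>x \<in> lcosets\<^bsub>heisenberg_complex\<^esub> (complexified_subgroup H).
     complexify g <#\<^bsub>heisenberg_complex\<^esub> x)"

end

theory Submission
  imports Defs
begin

text \<open>
  Let \<open>\<hh>\<close> be the Lie algebra of \<open>H\<close>, and let \<open>symp\<close> be the alternating form with \<open>[v, w] = symp v w Z\<close>. The
  quotient \<open>G\<^sup>\<complex> / H\<^sup>\<complex>\<close> is identified with \<open>\<complex>\<^sup>m\<close> by one global chart, in which the action, the slice and
  the anti-holomorphic map are explicit.

  If \<open>Z \<in> \<hh>\<close>, then \<open>G\<^sup>\<complex> / H\<^sup>\<complex>\<close> is the vector group \<open>\<complex>\<^sup>m\<close> and \<open>G\<close> acts on it by all real translations. The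
  orbits are the sets of constant imaginary part; the reflection \<open>z \<mapsto> - cnj z\<close> preserves them, and it fixes
  the purely imaginary vectors, which meet every orbit.

  If \<open>Z \<notin> \<hh>\<close>, then \<open>\<hh>\<close> is isotropic for \<open>symp\<close>, because brackets of its elements are multiples of \<open>Z\<close>. Choose
  a linear complement of \<open>\<hh>\<close> that contains \<open>Z\<close>. Every element of \<open>G\<^sup>\<complex>\<close> is uniquely a product of an element of
  the complexified complement and one of \<open>H\<^sup>\<complex>\<close>, which gives the chart (\<open>coset_param\<close>, \<open>coset_param_eq_iff\<close>). In it, \<open>G\<close> acts by real
  translations modulo multiples of the coordinate vector \<open>center\<close> of \<open>Z\<close> (\<open>move_eq\<close>). What happens along
  \<open>center\<close> is the point of the theorem. As \<open>H\<close> is closed, connected and not \<open>{e}\<close>, there is a non-zero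
  \<open>g \<in> \<hh>\<close> (\<open>lie_algebra_of_nontrivial\<close>). The elements \<open>exp (s g)\<close> move the point \<open>z\<close> by
  \<open>s * symp g (lift z)\<close> along \<open>center\<close>. Where this number is not real, which is an open condition on \<open>z\<close> that can be
  satisfied because \<open>g\<close> is not central, these elements and the real multiples of \<open>Z\<close> yield all complex
  multiples of \<open>center\<close>. So the orbit of such a generic point \<open>z\<close> is \<open>z + \<real>\<^sup>m + \<complex> center\<close> (\<open>orbit_generic\<close>), and the
  same reflection \<open>z \<mapsto> - cnj z\<close> preserves it. The slice consists of the generic purely imaginary vectors.

  The two cases are treated together: with \<open>center = 0\<close> in the first case, all formulas of the second
  one hold, and every point is generic.
\<close>

section \<open>Smooth and holomorphic quadratic maps\<close>

lemma Ck_on_cong: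
  assumes "open S" "\<And>x. x \<in> S \<Longrightarrow> f x = g x" "Ck_on k f S"
  shows "Ck_on k g S"
  using assms(2,3)
proof (induction k arbitrary: f g)
  case 0
  then show ?case by (simp cong: continuous_on_cong)
next
  case (Suc k)
  have deriv: "(g has_derivative frechet_derivative f (at x)) (at x)" if "x \<in> S" for x
    using Suc.prems that \<open>open S\<close>
    by (auto intro!: has_derivative_transform_within_open[of f _ x UNIV S g]
        simp: frechet_derivative_works[symmetric])
  then have eq: "frechet_derivative f (at x) v = frechet_derivative g (at x) v" if "x \<in> S" for x v
    using frechet_derivative_at that by metis
  then have "Ck_on k (\<lambda>x. frechet_derivative g (at x) v) S" for v
    using Suc.prems(2) by (intro Suc.IH[OF eq]) auto
  moreover have "g differentiable at x" if "x \<in> S" for x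
    using deriv[OF that] by (auto simp: differentiable_def)
  ultimately show ?case by simp
qed

lemma smooth_cong: "open S \<Longrightarrow> (\<And>x. x \<in> S \<Longrightarrow> f x = g x) \<Longrightarrow> smooth f S \<Longrightarrow> smooth g S"
  unfolding smooth_def by (blast intro: Ck_on_cong)

lemma has_derivative_quadratic:
  fixes A :: "'a::euclidean_space \<Rightarrow> 'b::euclidean_space"
  assumes "linear A" "bilinear B"
  shows "((\<lambda>x. c + A x + B x x) has_derivative (\<lambda>v. A v + (B x v + B v x))) (at x)"
proof -
  have "bounded_linear A" "bounded_bilinear B"
    using assms by (auto simp: linear_conv_bounded_linear bilinear_conv_bounded_bilinear)
  from this(1) bounded_bilinear.FDERIV[OF this(2) has_derivative_ident has_derivative_ident]
  show ?thesis
    by (auto intro!: derivative_eq_intros bounded_linear_imp_has_derivative)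
qed

lemma Ck_on_const: "Ck_on k (\<lambda>x. c) S"
  by (induction k arbitrary: c) (auto simp: frechet_derivative_const)

lemma Ck_on_affine:
  fixes A :: "'a::euclidean_space \<Rightarrow> 'b::euclidean_space"
  assumes "linear A"
  shows "Ck_on k (\<lambda>x. c + A x) S"
proof -
  have "((\<lambda>x. c + A x) has_derivative A) (at x)" for x
    using assms by (auto intro!: derivative_eq_intros bounded_linear_imp_has_derivative
        simp: linear_conv_bounded_linear)
  then have "(\<lambda>x. c + A x) differentiable at x"
    "frechet_derivative (\<lambda>x. c + A x) (at x) = A" for x
    by (auto simp: differentiable_def frechet_derivative_at[symmetric])
  then show ?thesis
    by (cases k) (auto simp: Ck_on_const intro!: continuous_at_imp_continuous_on
        differentiable_imp_continuous_within)
qed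

text \<open>
  The directional derivatives are affine and those of second order are constant. Products and actions
  of Heisenberg groups are polynomial maps of degree two in suitable coordinates, so this covers all
  smooth maps that occur below.
\<close>

lemma smooth_quadratic:
  fixes A :: "'a::euclidean_space \<Rightarrow> 'b::euclidean_space"
  assumes A: "linear A" and B: "bilinear B"
  shows "smooth (\<lambda>x. c + A x + B x x) S"
proof -
  have "(\<lambda>x. c + A x + B x x) differentiable at x"
    "frechet_derivative (\<lambda>x. c + A x + B x x) (at x) v = A v + (B x v + B v x)" for x v
    using has_derivative_quadratic[OF assms, of c x]
    by (auto simp: differentiable_def frechet_derivative_at[symmetric])
  moreover have "linear (\<lambda>x. B x v + B v x)" for v
    using B by (auto simp: bilinear_def intro: linear_compose_add)
  ultimately have "Ck_on k (\<lambda>x. c + A x + B x x) S" for k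
    by (cases k) (auto simp: Ck_on_affine intro!: continuous_at_imp_continuous_on
        differentiable_imp_continuous_within)
  then show ?thesis by (simp add: smooth_def)
qed

lemma smooth_linear: "linear A \<Longrightarrow> smooth A S"
  using smooth_quadratic[of A "\<lambda>x y. 0" 0 S] by (simp add: bilinear_def module_hom_zero)

lemma scaleR_eq_of_real_scalar_mult: "c *\<^sub>R (v :: complex^'n) = complex_of_real c *s v"
  by (simp add: vec_eq_iff complex_eq_iff)

lemma complex_linear_imp_linear:
  fixes f :: "complex^'a \<Rightarrow> complex^'b"
  assumes "\<And>x y. f (x + y) = f x + f y" "\<And>c x. f (c *s x) = c *s f x"
  shows "linear f"
  using assms by (intro linearI) (simp_all add: scaleR_eq_of_real_scalar_mult)

lemma holomorphic_vec_quadratic: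
  fixes A :: "complex^'a \<Rightarrow> complex^'b"
  assumes "linear A" "bilinear B"
    and "\<And>c v. A (c *s v) = c *s A v" "\<And>c v w. B (c *s v) w = c *s B v w" "\<And>c v w. B v (c *s w) = c *s B v w"
  shows "holomorphic_vec (\<lambda>x. c + A x + B x x) S"
  unfolding holomorphic_vec_def
proof
  fix x
  show "\<exists>f'. ((\<lambda>x. c + A x + B x x) has_derivative f') (at x) \<and> (\<forall>c v. f' (c *s v) = c *s f' v)"
    using has_derivative_quadratic[OF assms(1,2)] assms(3-)
    by (intro exI conjI) (auto simp: algebra_simps vec_eq_iff)
qed

lemma holomorphic_vec_affine:
  fixes A :: "complex^'a \<Rightarrow> complex^'b"
  assumes "linear A" and "\<And>c v. A (c *s v) = c *s A v"
  shows "holomorphic_vec (\<lambda>x. c + A x) S"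
  using holomorphic_vec_quadratic[of A "\<lambda>x y. 0"] assms by (simp add: bilinear_def module_hom_zero)

lemma antiholomorphic_vec_linear:
  fixes A :: "complex^'a \<Rightarrow> complex^'b"
  assumes "linear A" and "\<And>c v. A (c *s v) = cnj c *s A v"
  shows "antiholomorphic_vec A S"
  unfolding antiholomorphic_vec_def using assms
  by (auto simp: linear_conv_bounded_linear intro!: exI[of _ A] bounded_linear_imp_has_derivative)

lemma holomorphic_vec_imp_continuous_on: "holomorphic_vec f S \<Longrightarrow> continuous_on S f"
  unfolding holomorphic_vec_def
  by (meson continuous_at_imp_continuous_on has_derivative_continuous)

lemma holomorphic_vec_compose:
  assumes "holomorphic_vec g T" "holomorphic_vec f S" "f ` S \<subseteq> T"
  shows "holomorphic_vec (g \<circ> f) S"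
  unfolding holomorphic_vec_def
proof
  fix x assume "x \<in> S"
  with assms obtain f' g' where "(f has_derivative f') (at x)" "\<forall>c v. f' (c *s v) = c *s f' v"
    "(g has_derivative g') (at (f x))" "\<forall>c v. g' (c *s v) = c *s g' v"
    unfolding holomorphic_vec_def by blast
  then show "\<exists>h. ((g \<circ> f) has_derivative h) (at x) \<and> (\<forall>c v. h (c *s v) = c *s h v)"
    by (intro exI[of _ "g' \<circ> f'"]) (auto intro: diff_chain_at)
qed

lemma holomorphic_vec_subset: "holomorphic_vec f S \<Longrightarrow> T \<subseteq> S \<Longrightarrow> holomorphic_vec f T"
  unfolding holomorphic_vec_def by blast

lemma holomorphic_vec_locally:
  assumes "\<And>x. x \<in> S \<Longrightarrow> \<exists>N g. open N \<and> x \<in> N \<and> holomorphic_vec g N \<and> (\<forall>y\<in>N. g y = f y)"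
  shows "holomorphic_vec f S"
  unfolding holomorphic_vec_def
proof
  fix x assume "x \<in> S"
  with assms obtain N g where N: "open N" "x \<in> N" "holomorphic_vec g N" "\<forall>y\<in>N. g y = f y"
    by meson
  then obtain g' where "(g has_derivative g') (at x)" "\<forall>c v. g' (c *s v) = c *s g' v"
    unfolding holomorphic_vec_def by blast
  with N show "\<exists>f'. (f has_derivative f') (at x) \<and> (\<forall>c v. f' (c *s v) = c *s f' v)"
    using has_derivative_transform_within_open by blast
qed

section \<open>Vector spaces as manifolds\<close>

lemma second_countable_space_euclidean:
  "second_countable_space (euclidean :: 'a::second_countable_topology topology)"
proof -
  obtain B :: "'a set set" where "countable B" "topological_basis B"
    using ex_countable_basis by blast
  then show ?thesis
    unfolding second_countable_space_def
    by (metis open_openin topological_basis_open topological_basisE)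
qed

lemma smooth_manifold_model_manifold:
  "smooth_manifold (model_manifold :: ('e::euclidean_space, 'e) charted_space)"
proof -
  have "homeomorphic_map euclidean euclidean (id :: 'e \<Rightarrow> 'e)"
    using homeomorphic_map_id by blast
  moreover have "inv_into UNIV id = (id :: 'e \<Rightarrow> 'e)"
    by (rule ext, rule inv_into_f_eq) auto
  ultimately show ?thesis
    unfolding manifold_wrt_def model_manifold_def is_chart_def
    by (simp add: second_countable_space_euclidean smooth_linear linear_id)
qed

lemma manifold_map_model_manifold:
  assumes "P f UNIV" shows "manifold_map P model_manifold model_manifold f"
proof -
  have "inv_into UNIV id = (id :: 'a \<Rightarrow> 'a)"
    by (rule ext, rule inv_into_f_eq) auto
  then show ?thesis
    unfolding manifold_map_def model_manifold_def using assms by auto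
qed

lemma prod_manifold_model_manifold:
  "prod_manifold model_manifold model_manifold = model_manifold"
  by (simp add: prod_manifold_def model_manifold_def euclidean_product_topology map_prod.id)

section \<open>Homogeneous spaces with a global chart\<close>

lemma openin_quotient_topology:
  "openin (quotient_topology K H) U \<longleftrightarrow> U \<subseteq> lcosets\<^bsub>K\<^esub> H \<and> open {g. g <#\<^bsub>K\<^esub> H \<in> U}"
proof -
  have "istopology (\<lambda>U. U \<subseteq> lcosets\<^bsub>K\<^esub> H \<and> open {g. g <#\<^bsub>K\<^esub> H \<in> U})"
    unfolding istopology_def
  proof (intro conjI allI impI)
    fix \<U> assume "\<forall>U\<in>\<U>. U \<subseteq> lcosets\<^bsub>K\<^esub> H \<and> open {g. g <#\<^bsub>K\<^esub> H \<in> U}"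
    moreover have "{g. g <#\<^bsub>K\<^esub> H \<in> \<Union>\<U>} = (\<Union>U\<in>\<U>. {g. g <#\<^bsub>K\<^esub> H \<in> U})"
      by auto
    ultimately show "\<Union>\<U> \<subseteq> lcosets\<^bsub>K\<^esub> H" "open {g. g <#\<^bsub>K\<^esub> H \<in> \<Union>\<U>}"
      by auto
  qed (auto simp: open_Int Collect_conj_eq)
  then show ?thesis
    unfolding quotient_topology_def by simp
qed

lemma top_of_homogeneous_space [simp]: "top_of (homogeneous_space K H) = quotient_topology K H"
  by (simp add: homogeneous_space_def)

lemma atlas_homogeneous_spaceD:
  assumes "(U, \<phi>) \<in> atlas_of (homogeneous_space K H)"
  shows "openin (quotient_topology K H) U" "inj_on \<phi> U" "open (\<phi> ` U)"
    "holomorphic_vec (\<lambda>g. \<phi> (g <#\<^bsub>K\<^esub> H)) {g. g <#\<^bsub>K\<^esub> H \<in> U}"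
  using assms by (auto simp: homogeneous_space_def)

text \<open>
  Local lifts of an inverse chart can be shrunk into any open set of cosets. Near a point, a second chart
  composed with \<open>inv_into U \<phi>\<close> is therefore its holomorphic pullback to the group composed with a
  holomorphic lift.
\<close>

lemma homogeneous_space_local_section:
  assumes \<phi>: "(U, \<phi>) \<in> atlas_of (homogeneous_space K H)"
    and V: "openin (quotient_topology K H) V" and x: "x \<in> U" "x \<in> V"
  obtains N s where "open N" "\<phi> x \<in> N" "N \<subseteq> \<phi> ` (U \<inter> V)" "holomorphic_vec s N"
    "\<And>w. w \<in> N \<Longrightarrow> s w <#\<^bsub>K\<^esub> H = inv_into U \<phi> w"
    "\<And>w. w \<in> N \<Longrightarrow> s w <#\<^bsub>K\<^esub> H \<in> U \<inter> V"
proof -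
  have "\<phi> x \<in> \<phi> ` U" using x by simp
  with \<phi> obtain N s where N: "open N" "\<phi> x \<in> N" "N \<subseteq> \<phi> ` U" "holomorphic_vec s N"
      "\<forall>w\<in>N. s w <#\<^bsub>K\<^esub> H \<in> U \<and> \<phi> (s w <#\<^bsub>K\<^esub> H) = w"
    unfolding homogeneous_space_def by auto
  have inj: "inj_on \<phi> U" using \<phi> by (rule atlas_homogeneous_spaceD)
  have eq: "s w <#\<^bsub>K\<^esub> H = inv_into U \<phi> w" if "w \<in> N" for w
    using N(5) that inj by (metis inv_into_f_f)
  define N' where "N' = N \<inter> s -` {g. g <#\<^bsub>K\<^esub> H \<in> V}"
  have "open N'"
    using continuous_on_open_vimage[OF \<open>open N\<close>, of s] holomorphic_vec_imp_continuous_on[OF N(4)] V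
    unfolding N'_def openin_quotient_topology by (metis Int_commute)
  moreover have "\<phi> x \<in> N'"
    using N(2) eq[OF N(2)] x inj by (auto simp: N'_def)
  moreover have "N' \<subseteq> \<phi> ` (U \<inter> V)"
    using N(5) unfolding N'_def by force
  ultimately show ?thesis
    using N eq by (intro that[of N' s]) (auto simp: N'_def intro: holomorphic_vec_subset)
qed

text \<open>
  Continuity is tested on the pullback to the group, by definition of the quotient topology. The chart is
  open because the image of an open set contains the domain of a local lift around each of its points.
\<close>

lemma homogeneous_space_is_chart:
  assumes \<phi>: "(U, \<phi>) \<in> atlas_of (homogeneous_space K H)"
  shows "is_chart (quotient_topology K H) U \<phi>"
proof -
  let ?X = "quotient_topology K H"
  note U = atlas_homogeneous_spaceD[OF \<phi>]
  have sub: "topspace (subtopology ?X U) = U"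
    using openin_subset[OF U(1)] by auto
  have "openin ?X {x \<in> U. \<phi> x \<in> T}" if "open T" for T
  proof -
    have "{g. g <#\<^bsub>K\<^esub> H \<in> U \<and> \<phi> (g <#\<^bsub>K\<^esub> H) \<in> T}
        = (\<lambda>g. \<phi> (g <#\<^bsub>K\<^esub> H)) -` T \<inter> {g. g <#\<^bsub>K\<^esub> H \<in> U}"
      by auto
    moreover have "open {g. g <#\<^bsub>K\<^esub> H \<in> U}"
      using U(1) by (simp add: openin_quotient_topology)
    ultimately have "open {g. g <#\<^bsub>K\<^esub> H \<in> U \<and> \<phi> (g <#\<^bsub>K\<^esub> H) \<in> T}"
      using continuous_on_open_vimage[THEN iffD1, OF _ holomorphic_vec_imp_continuous_on[OF U(4)]] that
      by simp
    with U(1) show ?thesis by (auto simp: openin_quotient_topology)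
  qed
  then have "continuous_map (subtopology ?X U) euclidean \<phi>"
    unfolding continuous_map_def openin_subtopology_alt sub using U(1)
    by (auto simp: openin_open_subtopology[OF U(1)])
  then have "continuous_map (subtopology ?X U) (top_of_set (\<phi> ` U)) \<phi>"
    by (simp add: continuous_map_in_subtopology sub)
  moreover have "open (\<phi> ` V)" if V: "openin ?X V" "V \<subseteq> U" for V
  proof (subst open_subopen, intro ballI)
    fix z assume "z \<in> \<phi> ` V"
    then obtain x where "x \<in> V" "z = \<phi> x" by auto
    with homogeneous_space_local_section[OF \<phi> V(1), of x] V(2)
    show "\<exists>T. open T \<and> z \<in> T \<and> T \<subseteq> \<phi> ` V"
      by (metis Int_absorb1 subsetD)
  qed
  then have "open_map (subtopology ?X U) (top_of_set (\<phi> ` U)) \<phi>"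
    using U(3) by (auto simp: open_map_def openin_open_subtopology[OF U(1)] openin_open_eq)
  ultimately have "homeomorphic_map (subtopology ?X U) (top_of_set (\<phi> ` U)) \<phi>"
    using U(2) sub by (intro bijective_open_imp_homeomorphic_map) auto
  with U show ?thesis by (simp add: is_chart_def)
qed

lemma homogeneous_space_transition:
  assumes \<phi>: "(U, \<phi>) \<in> atlas_of (homogeneous_space K H)"
    and \<psi>: "(V, \<psi>) \<in> atlas_of (homogeneous_space K H)"
  shows "holomorphic_vec (\<psi> \<circ> inv_into U \<phi>) (\<phi> ` (U \<inter> V))"
proof (rule holomorphic_vec_locally)
  fix z assume "z \<in> \<phi> ` (U \<inter> V)"
  then obtain x where x: "x \<in> U" "x \<in> V" "z = \<phi> x" by auto
  from homogeneous_space_local_section[OF \<phi> atlas_homogeneous_spaceD(1)[OF \<psi>] x(1,2)]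
  obtain N s where N: "open N" "\<phi> x \<in> N" "N \<subseteq> \<phi> ` (U \<inter> V)" "holomorphic_vec s N"
    "\<And>w. w \<in> N \<Longrightarrow> s w <#\<^bsub>K\<^esub> H = inv_into U \<phi> w"
    "\<And>w. w \<in> N \<Longrightarrow> s w <#\<^bsub>K\<^esub> H \<in> U \<inter> V" by blast
  then have "holomorphic_vec ((\<lambda>g. \<psi> (g <#\<^bsub>K\<^esub> H)) \<circ> s) N"
    by (intro holomorphic_vec_compose[OF atlas_homogeneous_spaceD(4)[OF \<psi>]]) auto
  with N x show "\<exists>N g. open N \<and> z \<in> N \<and> holomorphic_vec g N \<and> (\<forall>y\<in>N. g y = (\<psi> \<circ> inv_into U \<phi>) y)"
    by (intro exI[of _ N] exI[of _ "(\<lambda>g. \<psi> (g <#\<^bsub>K\<^esub> H)) \<circ> s"]) auto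
qed

lemma second_countable_space_homeomorphic_map:
  assumes f: "homeomorphic_map X Y f" and "second_countable_space Y"
  shows "second_countable_space X"
proof -
  from assms obtain \<B> where \<B>: "countable \<B>" "\<forall>B\<in>\<B>. openin Y B"
    "\<forall>U y. openin Y U \<and> y \<in> U \<longrightarrow> (\<exists>B\<in>\<B>. y \<in> B \<and> B \<subseteq> U)"
    unfolding second_countable_space_def by blast
  let ?pre = "\<lambda>B. {x \<in> topspace X. f x \<in> B}"
  have "\<exists>B\<in>\<B>. x \<in> ?pre B \<and> ?pre B \<subseteq> U" if "openin X U" "x \<in> U" for U x
  proof -
    have "openin Y (f ` U)"
      using f that(1) by (simp add: homeomorphic_map_openness_eq)
    with \<B>(3) that(2) obtain B where "B \<in> \<B>" "f x \<in> B" "B \<subseteq> f ` U" by blast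
    moreover have "U \<subseteq> topspace X" "inj_on f (topspace X)"
      using f that(1) by (auto simp: homeomorphic_eq_everything_map dest: openin_subset)
    ultimately show ?thesis using that(2) by (intro bexI[of _ B]) (auto dest: inj_onD)
  qed
  moreover have "openin X (?pre B)" if "B \<in> \<B>" for B
    using f \<B>(2) that homeomorphic_imp_continuous_map openin_continuous_map_preimage by blast
  ultimately show ?thesis
    unfolding second_countable_space_def using \<B>(1)
    by (intro exI[of _ "?pre ` \<B>"]) auto
qed

text \<open>
  A holomorphic map whose fibres are the cosets, together with a holomorphic section, identifies the
  homogeneous space with \<open>\<complex>\<^sup>m\<close>: all manifold notions can then be read off in a single chart.
\<close>

locale global_coset_chart =
  fixes K :: "(complex^'k) monoid" and H :: "(complex^'k) set"
    and p :: "complex^'k \<Rightarrow> complex^'m" and r :: "complex^'m \<Rightarrow> complex^'k"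
  assumes carrier: "carrier K = UNIV"
    and fibres: "p g = p g' \<longleftrightarrow> g <#\<^bsub>K\<^esub> H = g' <#\<^bsub>K\<^esub> H"
    and p_r: "p (r z) = z"
    and holomorphic_p: "holomorphic_vec p UNIV"
    and holomorphic_r: "holomorphic_vec r UNIV"
begin

definition point :: "complex^'m \<Rightarrow> (complex^'k) set" where
  "point z = r z <#\<^bsub>K\<^esub> H"

definition coord :: "(complex^'k) set \<Rightarrow> complex^'m" where
  "coord = inv_into UNIV point"

abbreviation space :: "((complex^'k) set, complex^'m) charted_space" where
  "space \<equiv> homogeneous_space K H"

lemma coset_eq_point: "g <#\<^bsub>K\<^esub> H = point (p g)"
  unfolding point_def using fibres p_r by metis

lemma inj_point: "inj point"
  by (rule injI) (metis fibres point_def p_r)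

lemma point_eq_iff [simp]: "point z = point w \<longleftrightarrow> z = w"
  using inj_point by (auto dest: injD)

lemma coord_point [simp]: "coord (point z) = z"
  by (simp add: coord_def inj_point)

lemma lcosets_eq: "lcosets\<^bsub>K\<^esub> H = range point"
  by (auto simp: LCOSETS_def carrier coset_eq_point) (metis p_r)

lemma openin_space_iff:
  "openin (top_of space) U \<longleftrightarrow> (\<exists>V. open V \<and> U = point ` V)"
proof
  assume "openin (top_of space) U"
  then have U: "U \<subseteq> range point" "open {g. point (p g) \<in> U}"
    by (auto simp: openin_quotient_topology lcosets_eq coset_eq_point)
  \<comment> \<open>The section \<open>r\<close> pulls the preimage of \<open>U\<close> in the group back to the coordinate space.\<close>
  have "open (r -` {g. point (p g) \<in> U})"
    using U(2) holomorphic_r by (blast intro: open_vimage holomorphic_vec_imp_continuous_on)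
  moreover have "U = point ` (r -` {g. point (p g) \<in> U})"
    using U(1) by (auto simp: p_r)
  ultimately show "\<exists>V. open V \<and> U = point ` V" by blast
next
  assume "\<exists>V. open V \<and> U = point ` V"
  then obtain V where "open V" "U = point ` V" by blast
  moreover from this have "{g. point (p g) \<in> U} = p -` V" by auto
  ultimately show "openin (top_of space) U"
    using holomorphic_p
    by (auto simp: openin_quotient_topology lcosets_eq coset_eq_point
        intro: open_vimage holomorphic_vec_imp_continuous_on)
qed

lemma openin_point_image: "open V \<Longrightarrow> openin (top_of space) (point ` V)"
  unfolding openin_space_iff by (intro exI[of _ V]) simp

lemma topspace_space: "topspace (top_of space) = range point"
proof
  show "topspace (top_of space) \<subseteq> range point"
    using openin_space_iff[of "topspace (top_of space)"] openin_topspace by auto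
  show "range point \<subseteq> topspace (top_of space)"
    by (intro openin_subset openin_point_image) simp
qed

lemma coord_in_atlas: "(range point, coord) \<in> atlas_of space"
proof -
  have image: "coord ` range point = UNIV"
    by (simp add: image_image)
  moreover have "openin (quotient_topology K H) (range point)"
    using openin_point_image[of UNIV] by simp
  moreover have "holomorphic_vec (\<lambda>g. coord (g <#\<^bsub>K\<^esub> H)) {g. g <#\<^bsub>K\<^esub> H \<in> range point}"
    using holomorphic_p by (simp add: coset_eq_point)
  moreover have "\<exists>N s. open N \<and> z \<in> N \<and> N \<subseteq> coord ` range point \<and> holomorphic_vec s N \<and>
      (\<forall>w\<in>N. s w <#\<^bsub>K\<^esub> H \<in> range point \<and> coord (s w <#\<^bsub>K\<^esub> H) = w)" for z
    using holomorphic_r unfolding image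
    by (intro exI[of _ UNIV] exI[of _ r]) (simp add: coset_eq_point p_r)
  moreover have "inj_on coord (range point)"
    by (simp add: inj_on_def)
  ultimately show ?thesis
    unfolding homogeneous_space_def by simp
qed

lemma homeomorphic_map_coord: "homeomorphic_map (top_of space) euclidean coord"
proof -
  have "homeomorphic_map (subtopology (top_of space) (range point)) (top_of_set (coord ` range point)) coord"
    using homogeneous_space_is_chart[OF coord_in_atlas] by (simp add: is_chart_def)
  moreover have "subtopology (top_of space) (range point) = top_of space"
    unfolding topspace_space[symmetric] by (rule subtopology_topspace)
  ultimately show ?thesis by (simp add: image_image)
qed

lemmas homeomorphic_space_coord = homeomorphic_map_imp_homeomorphic_space[OF homeomorphic_map_coord]

lemma complex_manifold_space: "complex_manifold space"
  unfolding manifold_wrt_def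
proof (intro conjI)
  show "Hausdorff_space (top_of space)"
    by (rule iffD2[OF homeomorphic_Hausdorff_space[OF homeomorphic_space_coord] Hausdorff_space_euclidean])
  show "second_countable_space (top_of space)"
    by (rule second_countable_space_homeomorphic_map[OF homeomorphic_map_coord
          second_countable_space_euclidean])
  show "topspace (top_of space) = (\<Union>(U, \<phi>)\<in>atlas_of space. U)"
  proof
    show "topspace (top_of space) \<subseteq> (\<Union>(U, \<phi>)\<in>atlas_of space. U)"
      unfolding topspace_space by (intro subsetI UN_I[OF coord_in_atlas]) simp
    show "(\<Union>(U, \<phi>)\<in>atlas_of space. U) \<subseteq> topspace (top_of space)"
    proof clarify
      fix U and \<phi> :: "(complex^'k) set \<Rightarrow> complex^'m" and x
      assume "(U, \<phi>) \<in> atlas_of space" "x \<in> U"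
      then show "x \<in> topspace (top_of space)"
        unfolding top_of_homogeneous_space
        by (rule subsetD[OF openin_subset[OF atlas_homogeneous_spaceD(1)]])
    qed
  qed
  show "\<forall>(U, \<phi>)\<in>atlas_of space. is_chart (top_of space) U \<phi>"
    by (intro ballI case_prodI2) (simp add: homogeneous_space_is_chart)
  show "\<forall>(U, \<phi>)\<in>atlas_of space. \<forall>(V, \<psi>)\<in>atlas_of space.
      holomorphic_vec (\<psi> \<circ> inv_into U \<phi>) (\<phi> ` (U \<inter> V))"
    by (intro ballI case_prodI2) (simp add: homogeneous_space_transition)
qed

lemma connected_space_space: "connected_space (top_of space)"
proof -
  have "connectedin euclidean (UNIV :: (complex^'m) set)"
    by (simp add: convex_connected)
  then have "connected_space (euclidean :: (complex^'m) topology)"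
    by (simp only: connectedin_def subtopology_UNIV)
  then show ?thesis
    by (rule iffD2[OF homeomorphic_connected_space[OF homeomorphic_space_coord]])
qed

lemma inv_into_coord [simp]: "inv_into (range point) coord z = point z"
  by (rule inv_into_f_eq) (auto simp: inj_on_def)

lemma manifold_map_space:
  assumes "P F UNIV" "\<And>z. f (point z) = point (F z)"
  shows "manifold_map P space space f"
  unfolding manifold_map_def
proof
  fix x assume "x \<in> topspace (top_of space)"
  moreover have "coord \<circ> f \<circ> inv_into (range point) coord = F"
    using assms(2) by auto
  ultimately show "\<exists>(U, \<phi>)\<in>atlas_of space. \<exists>(V, \<psi>)\<in>atlas_of space. \<exists>W.
      x \<in> U \<and> open W \<and> \<phi> x \<in> W \<and> W \<subseteq> \<phi> ` U \<and> f ` inv_into U \<phi> ` W \<subseteq> V \<and>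
      P (\<psi> \<circ> f \<circ> inv_into U \<phi>) W"
    using assms topspace_space
    by (intro bexI[OF _ coord_in_atlas] case_prodI exI[of _ UNIV]) (auto simp: image_image)
qed

lemma manifold_map_prod_space:
  assumes "P F UNIV" "\<And>g z. f (g, point z) = point (F (g, z))"
  shows "manifold_map P (prod_manifold model_manifold space) space f"
  unfolding manifold_map_def
proof
  fix x assume x: "x \<in> topspace (top_of (prod_manifold (model_manifold :: ('a, 'a) charted_space) space))"
  let ?U = "UNIV \<times> range point" and ?\<phi> = "map_prod (id :: 'a \<Rightarrow> 'a) coord"
  have chart: "(?U, ?\<phi>) \<in> atlas_of (prod_manifold model_manifold space)"
    using coord_in_atlas by (auto simp: prod_manifold_def model_manifold_def)
  have inv: "inv_into ?U ?\<phi> y = (fst y, point (snd y))" for y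
    by (rule inv_into_f_eq) (auto simp: inj_on_def)
  have surj: "?\<phi> ` ?U = UNIV"
    by (auto simp: image_image map_prod_surj_on)
  have "coord \<circ> f \<circ> inv_into ?U ?\<phi> = F"
    using assms(2) by (auto simp: inv)
  moreover have "x \<in> ?U"
    using x topspace_space by (auto simp: prod_manifold_def model_manifold_def)
  ultimately show "\<exists>(U, \<phi>)\<in>atlas_of (prod_manifold model_manifold space). \<exists>(V, \<psi>)\<in>atlas_of space. \<exists>W.
      x \<in> U \<and> open W \<and> \<phi> x \<in> W \<and> W \<subseteq> \<phi> ` U \<and> f ` inv_into U \<phi> ` W \<subseteq> V \<and>
      P (\<psi> \<circ> f \<circ> inv_into U \<phi>) W"
    using assms surj
    by (intro bexI[OF _ chart] bexI[OF _ coord_in_atlas] case_prodI exI[of _ UNIV]) (auto simp: inv)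
qed

text \<open>
  The identity is a slice chart: inside the open set \<open>W\<close> of the global chart, the subset is already
  cut out by a linear subspace.
\<close>

lemma real_submanifold_space:
  assumes "subspace T" "open W"
  shows "real_submanifold space (point ` (T \<inter> W))"
proof -
  have "smooth (inv_into W id) W"
    by (rule smooth_cong[OF \<open>open W\<close> _ smooth_linear[OF linear_id]]) (simp add: inv_into_f_f[of id, simplified])
  then have "smooth_diffeo W W id"
    using assms by (auto simp: smooth_diffeo_def smooth_linear linear_id)
  moreover have "coord ` (point ` (T \<inter> W) \<inter> range point) \<inter> W = T \<inter> W"
  proof -
    have "point ` (T \<inter> W) \<inter> range point = point ` (T \<inter> W)" by blast
    then show ?thesis by (simp add: image_image)
  qed
  ultimately have "\<exists>W1 W' \<Phi> T'. x \<in> range point \<and> coord x \<in> W1 \<and> W1 \<subseteq> coord ` range point \<and>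
      smooth_diffeo W1 W' \<Phi> \<and> subspace T' \<and> dim T' = dim T \<and>
      \<Phi> ` (coord ` (point ` (T \<inter> W) \<inter> range point) \<inter> W1) = T' \<inter> W'"
    if "x \<in> point ` (T \<inter> W)" for x
    using that assms(1)
    by - (rule exI[of _ W], rule exI[of _ W], rule exI[of _ id], rule exI[of _ T], auto simp: image_image)
  moreover have "point ` (T \<inter> W) \<subseteq> topspace (top_of space)"
    unfolding topspace_space by blast
  ultimately show ?thesis
    unfolding real_submanifold_def
    by (intro conjI exI[of _ "dim T"] ballI bexI[OF _ coord_in_atlas] case_prodI)
qed

end

section \<open>Heisenberg groups\<close>

text \<open>
  The symplectic form on the span of the \<open>X\<^sub>i\<close> and \<open>Y\<^sub>i\<close>, extended by zero on \<open>Z\<close>: the bracket of \<open>v\<close> and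
  \<open>w\<close> is \<open>symp v w\<close> times \<open>Z\<close>.
\<close>

definition symp :: "'a::field^('n::finite heis_index) \<Rightarrow> 'a^('n heis_index) \<Rightarrow> 'a" where
  "symp v w = (\<Sum>i\<in>UNIV. v $ IX i * w $ IY i - v $ IY i * w $ IX i)"

lemma symp_simps [simp]:
  "symp (u + v) w = symp u w + symp v w" "symp w (u + v) = symp w u + symp w v"
  "symp (u - v) w = symp u w - symp v w" "symp w (u - v) = symp w u - symp w v"
  "symp (c *s v) w = c * symp v w" "symp v (c *s w) = c * symp v w"
  "symp (- v) w = - symp v w" "symp v (- w) = - symp v w"
  "symp (axis IZ c) w = 0" "symp w (axis IZ c) = 0"
  "symp 0 w = 0" "symp w 0 = 0" "symp v v = 0"
  by (simp_all add: symp_def axis_def sum.distrib sum_subtractf sum_distrib_left sum_negf algebra_simps)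

lemma symp_swap: "symp w v = - symp v w"
  by (simp add: symp_def sum_subtractf mult.commute)

lemma heis_bracket_symp: "heis_bracket v w = symp v w *s axis IZ 1"
  by (simp add: heis_bracket_def symp_def)

lemma heisenberg_mult: "v \<otimes>\<^bsub>heisenberg\<^esub> w = v + w + (symp v w / 2) *s axis IZ 1"
  by (simp add: heisenberg_def heis_bracket_symp)

lemma heisenberg_simps [simp]: "carrier heisenberg = UNIV" "\<one>\<^bsub>heisenberg\<^esub> = 0"
  by (simp_all add: heisenberg_def)

lemma heisenberg_inv: "inv\<^bsub>heisenberg\<^esub> v = - (v :: 'a::field^('n::finite heis_index))"
proof -
  interpret group "heisenberg :: ('a^('n heis_index)) monoid" by (rule group_heisenberg)
  show ?thesis by (rule inv_equality) (simp_all add: heisenberg_mult)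
qed

text \<open>
  Pairing with the \<open>Y\<^sub>i\<close> and \<open>X\<^sub>i\<close> reads off all coordinates except the one along \<open>Z\<close>.
\<close>

lemma symp_nondegenerate:
  assumes "\<And>w. symp v w = 0"
  shows "v = (v $ IZ) *s axis IZ (1 :: 'a::field)"
proof -
  have "symp v (axis (IY i) 1) = v $ IX i" "symp v (axis (IX i) 1) = - v $ IY i" for i
    by (simp_all add: symp_def axis_def if_distrib[where f="\<lambda>x. _ * x"] sum_negf cong: if_cong)
  with assms have "v $ IX i = 0" "v $ IY i = 0" for i
    by (metis, metis neg_0_equal_iff_equal)
  then have "v $ k = ((v $ IZ) *s axis IZ 1) $ k" for k
    by (cases k) (auto simp: axis_def)
  then show ?thesis unfolding vec_eq_iff by blast
qed

lemma card_heis_index: "CARD('n::finite heis_index) = 2 * CARD('n) + 1"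
proof -
  have "(UNIV :: 'n heis_index set) = range IX \<union> range IY \<union> {IZ}"
    by (auto simp: image_iff) (metis heis_index.exhaust)
  moreover have "card (range IX \<union> range IY \<union> {IZ :: 'n heis_index}) = 2 * CARD('n) + 1"
    by (subst card_Un_disjoint; (subst card_Un_disjoint)?)
      (auto simp: card_image inj_on_def)
  ultimately show ?thesis by simp
qed

lemma lie_group_heisenberg: "lie_group (heisenberg_real :: (real^('n::finite heis_index)) monoid) model_manifold"
proof -
  let ?B = "\<lambda>q q' :: (real^('n heis_index)) \<times> (real^('n heis_index)).
    (symp (fst q) (snd q') / 2) *s axis IZ 1 :: real^('n heis_index)"
  have "linear (\<lambda>q. ?B q q')" "linear (\<lambda>q'. ?B q q')" for q q'
    by (rule linearI; simp add: vec_eq_iff add_divide_distrib algebra_simps flip: scalar_mult_eq_scaleR)+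
  then have "bilinear ?B" unfolding bilinear_def by blast
  moreover have "linear (\<lambda>q :: (real^('n heis_index)) \<times> (real^('n heis_index)). fst q + snd q)"
    by (rule linearI) (simp_all add: algebra_simps)
  ultimately have "smooth (\<lambda>q. 0 + (fst q + snd q) + ?B q q) UNIV"
    by (intro smooth_quadratic)
  then have "smooth (\<lambda>(g, h). g \<otimes>\<^bsub>heisenberg_real\<^esub> h :: real^('n heis_index)) UNIV"
    by (simp add: heisenberg_mult case_prod_unfold)
  moreover have "smooth (\<lambda>g. inv\<^bsub>heisenberg_real\<^esub> g :: real^('n heis_index)) UNIV"
    unfolding heisenberg_inv by (intro smooth_linear linearI) simp_all
  ultimately show ?thesis
    unfolding lie_group_def prod_manifold_model_manifold
    by (intro conjI manifold_map_model_manifold group_heisenberg smooth_manifold_model_manifold)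
      (simp_all add: model_manifold_def)
qed

section \<open>The Lie algebra of a closed connected subgroup\<close>

context
  fixes H :: "(real^('n::finite heis_index)) set"
  assumes H: "subgroup H heisenberg_real"
begin

lemma subgroup_heisenbergD:
  "0 \<in> H" "x \<in> H \<Longrightarrow> - x \<in> H" "x \<in> H \<Longrightarrow> y \<in> H \<Longrightarrow> x + y + (symp x y / 2) *s axis IZ 1 \<in> H"
  using subgroup.one_closed[OF H] subgroup.m_inv_closed[OF H, of x] subgroup.m_closed[OF H, of x y]
  by (simp_all add: heisenberg_mult heisenberg_inv)

text \<open>
  The commutator of \<open>exp (t x)\<close> and \<open>exp y\<close> is \<open>exp (t [x, y])\<close>, since the bracket is central.
\<close>

lemma lie_algebra_of_bracket:
  assumes "x \<in> lie_algebra_of H" "y \<in> lie_algebra_of H"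
  shows "symp x y *s axis IZ 1 \<in> lie_algebra_of H"
  unfolding lie_algebra_of_def
proof safe
  fix t
  let ?Z = "axis IZ 1 :: real^('n heis_index)"
  have x: "t *s x \<in> H" and y: "1 *s y \<in> H"
    using assms unfolding lie_algebra_of_def by blast+
  then have xy: "t *s x + y + (t * symp x y / 2) *s ?Z \<in> H"
    using subgroup_heisenbergD(3)[of "t *s x" y] by simp
  have "t *s x + y + (t * symp x y / 2) *s ?Z + - (t *s x) + (t * symp x y / 2) *s ?Z \<in> H"
    using subgroup_heisenbergD(3)[OF xy subgroup_heisenbergD(2)[OF x]] by (simp add: symp_swap[of y])
  also have "t *s x + y + (t * symp x y / 2) *s ?Z + - (t *s x) + (t * symp x y / 2) *s ?Z
      = y + (t * symp x y) *s ?Z"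
    by (simp add: vec_eq_iff)
  finally have z: "y + (t * symp x y) *s ?Z \<in> H" .
  have "- y \<in> H" using y subgroup_heisenbergD(2) by simp
  from subgroup_heisenbergD(3)[OF z this] show "t *s (symp x y *s ?Z) \<in> H"
    by simp
qed

text \<open>
  The product of \<open>exp (t x)\<close> and \<open>exp (t y)\<close> differs from \<open>exp (t (x + y))\<close> by the factor
  \<open>exp (t\<^sup>2 [x, y] / 2)\<close>, which lies in \<open>H\<close> because the bracket does.
\<close>

lemma subspace_lie_algebra_of: "subspace (lie_algebra_of H)"
  unfolding subspace_def
proof (intro conjI ballI allI)
  show "0 \<in> lie_algebra_of H"
    using subgroup_heisenbergD(1) by (simp add: lie_algebra_of_def)
next
  fix x y assume xy: "x \<in> lie_algebra_of H" "y \<in> lie_algebra_of H"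
  let ?Z = "axis IZ 1 :: real^('n heis_index)"
  show "x + y \<in> lie_algebra_of H"
    unfolding lie_algebra_of_def
  proof safe
    fix t
    have 1: "t *s x + t *s y + (t * t * symp x y / 2) *s ?Z \<in> H"
      using xy subgroup_heisenbergD(3)[of "t *s x" "t *s y"]
      by (simp add: lie_algebra_of_def mult_ac)
    have 2: "(- (t * t) / 2) *s (symp x y *s ?Z) \<in> H"
      using lie_algebra_of_bracket[OF xy] unfolding lie_algebra_of_def by blast
    from subgroup_heisenbergD(3)[OF 1 2] show "t *s (x + y) \<in> H"
      by (simp add: vec_eq_iff algebra_simps)
  qed
next
  fix c x assume "x \<in> lie_algebra_of H"
  then show "c *\<^sub>R x \<in> lie_algebra_of H"
    by (simp add: lie_algebra_of_def flip: scalar_mult_eq_scaleR)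
qed

lemma subgroup_int_multiple:
  assumes "x \<in> H" shows "of_int k *s x \<in> H"
proof -
  have nat: "of_nat j *s x \<in> H" for j
  proof (induction j)
    case (Suc j)
    from subgroup_heisenbergD(3)[OF this assms] show ?case
      by (simp add: algebra_simps)
  qed (simp add: subgroup_heisenbergD)
  show ?thesis
  proof (cases k)
    case (neg j)
    have "of_int k *s x = - (of_nat (Suc j) *s x)"
      by (simp add: neg vec_eq_iff algebra_simps)
    then show ?thesis using subgroup_heisenbergD(2)[OF nat[of "Suc j"]] by metis
  qed (use nat in simp)
qed

text \<open>
  If \<open>0\<close> were isolated in \<open>H\<close>, then \<open>{0}\<close> would be open and closed in the connected set \<open>H\<close>. So there are
  non-zero elements \<open>X\<^sub>k\<close> of \<open>H\<close> tending to \<open>0\<close>. A limit \<open>u\<close> of their directions works: the integer multiples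
  of \<open>X\<^sub>k\<close>, which are its powers, come within \<open>\<parallel>X\<^sub>k\<parallel>\<close> of \<open>t\<close> times its direction, so \<open>t u\<close> is a limit of
  elements of the closed set \<open>H\<close>.
\<close>

lemma lie_algebra_of_nontrivial:
  assumes closed: "closed H" and connected: "connected H" and "H \<noteq> {0}"
  obtains x where "x \<in> lie_algebra_of H" "x \<noteq> 0"
proof -
  have "\<exists>x\<in>H. x \<noteq> 0 \<and> norm x < e" if "e > 0" for e
  proof (rule ccontr)
    assume *: "\<not> ?thesis"
    have "H \<inter> ball 0 e = {0}"
      using * that subgroup_heisenbergD(1) by auto
    then have "openin (top_of_set H) {0}"
      by (metis openin_open_Int open_ball)
    moreover have "closedin (top_of_set H) {0}"
      using subgroup_heisenbergD(1) by (simp add: closed_subset)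
    ultimately show False
      using connected \<open>H \<noteq> {0}\<close> unfolding connected_clopen by blast
  qed
  then have "\<forall>k. \<exists>x\<in>H. x \<noteq> 0 \<and> norm x < inverse (real (Suc k))"
    by simp
  then obtain X where X: "\<And>k. X k \<in> H" "\<And>k. X k \<noteq> 0" "\<And>k. norm (X k) < inverse (real (Suc k))"
    by metis
  then have X0: "(\<lambda>k. norm (X k)) \<longlonglongrightarrow> 0"
    by (intro tendsto_sandwich[OF _ _ tendsto_const LIMSEQ_inverse_real_of_nat])
      (auto intro!: always_eventually less_imp_le)
  have "seq_compact (sphere (0 :: real^('n heis_index)) 1)"
    by (rule compact_imp_seq_compact) simp
  moreover have "\<forall>k. sgn (X k) \<in> sphere 0 1"
    using X(2) by (simp add: norm_sgn)
  ultimately obtain u r where u: "norm u = 1" and r: "strict_mono r"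
      and lim: "((\<lambda>k. sgn (X k)) \<circ> r) \<longlonglongrightarrow> u"
    unfolding seq_compact_def by (metis mem_sphere_0)
  have "t *s u \<in> H" for t
  proof -
    define Y where "Y k = of_int \<lfloor>t / norm (X k)\<rfloor> *s X k" for k
    have "norm (Y k - t *\<^sub>R sgn (X k)) \<le> norm (X k)" for k
    proof -
      have "Y k - t *\<^sub>R sgn (X k) = - frac (t / norm (X k)) *\<^sub>R X k"
        by (simp add: Y_def scalar_mult_eq_scaleR sgn_div_norm frac_def divide_inverse algebra_simps)
      then show ?thesis
        using frac_lt_1[of "t / norm (X k)"] frac_ge_0[of "t / norm (X k)"]
        by (simp add: mult_left_le_one_le)
    qed
    then have "(\<lambda>k. Y k - t *\<^sub>R sgn (X k)) \<longlonglongrightarrow> 0"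
      by (rule Lim_null_comparison[OF always_eventually[OF allI] X0])
    then have "(\<lambda>k. Y (r k) - t *\<^sub>R sgn (X (r k))) \<longlonglongrightarrow> 0"
      using LIMSEQ_subseq_LIMSEQ[OF _ r] by (force simp: o_def)
    from tendsto_add[OF this tendsto_scaleR[OF tendsto_const[of t] lim[unfolded o_def]]]
    have "(\<lambda>k. Y (r k)) \<longlonglongrightarrow> t *\<^sub>R u"
      by simp
    moreover have "Y (r k) \<in> H" for k
      unfolding Y_def by (rule subgroup_int_multiple[OF X(1)])
    ultimately show ?thesis
      using closed_sequentially[OF closed, of "\<lambda>k. Y (r k)" "t *\<^sub>R u"] by (simp add: scalar_mult_eq_scaleR)
  qed
  with u show ?thesis
    by (intro that[of u]) (auto simp: lie_algebra_of_def)
qed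

end

section \<open>Adapted coordinates and their complexification\<close>

text \<open>
  Linear coordinates on the quotient by \<open>h\<close> and a linear section of them. The vector \<open>c\<close> will be \<open>Z\<close>: if
  it is not in \<open>h\<close>, the complement of \<open>h\<close> onto which the section maps is chosen to contain it.
\<close>

lemma adapted_coordinates:
  fixes h :: "(real^'k) set" and c :: "real^'k"
  assumes h: "subspace h" and dim: "CARD('m::finite) + dim h = CARD('k)"
  obtains L :: "real^'k^'m" and R :: "real^'m^'k" where
    "L ** R = mat 1" "\<And>x. L *v x = 0 \<longleftrightarrow> x \<in> h" "c \<notin> h \<Longrightarrow> R *v (L *v c) = c"
proof -
  obtain B where B: "B \<subseteq> h" "independent B" "span B = h" "card B = dim h"
    using basis_exists[of h] h by (metis span_minimal subset_antisym)
  define B1 where "B1 = (if c \<in> h then B else insert c B)"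
  have "independent B1"
    using B by (auto simp: B1_def independent_insert)
  then obtain B' where B': "B1 \<subseteq> B'" "independent B'" "UNIV \<subseteq> span B'"
    using maximal_independent_subset_extend[of B1 UNIV] by auto
  have fin: "finite B'" using B'(2) by (rule independent_imp_finite)
  define C where "C = B' - B"
  have "card B' = CARD('k)"
    using dim_eq_card_independent[OF B'(2)] B'(3) dim_span[of B']
    by (simp add: top.extremum_unique)
  moreover have "B \<subseteq> B'" using B'(1) by (auto simp: B1_def split: if_splits)
  ultimately have "card C = CARD('m)"
    using dim B(4) fin by (simp add: C_def card_Diff_subset finite_subset)
  then obtain f where f: "bij_betw f (UNIV :: 'm set) C"
    using fin by (metis C_def finite_Diff finite_same_card_bij finite)
  obtain l :: "real^'k \<Rightarrow> real^'m" where l: "linear l" "\<forall>x\<in>B'. l x = (if x \<in> C then axis (inv_into UNIV f x) 1 else 0)"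
    using linear_independent_extend[OF B'(2), of "\<lambda>x. if x \<in> C then axis (inv_into UNIV f x) 1 else 0"]
    by metis
  \<comment> \<open>The new basis vectors \<open>C\<close> span the complement; \<open>f\<close> numbers them by the coordinates.\<close>
  define \<rho> where "\<rho> z = (\<Sum>i\<in>UNIV. z $ i *\<^sub>R f i)" for z :: "real^'m"
  have \<rho>: "linear \<rho>"
    unfolding \<rho>_def by (intro linear_compose_sum ballI linearI) (auto simp: algebra_simps)
  have lf: "l (f i) = axis i 1" for i
  proof -
    have "f i \<in> C" using f by (auto simp: bij_betw_def)
    with l(2) have "l (f i) = axis (inv_into UNIV f (f i)) 1" by (simp add: C_def)
    with f show ?thesis by (simp add: bij_betw_def)
  qed
  have l\<rho>: "l (\<rho> z) = z" for z
    by (simp add: \<rho>_def linear_sum[OF l(1)] linear_scale[OF l(1)] lf)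
      (simp add: vec_eq_iff axis_def if_distrib[where f="\<lambda>x. _ * x"] cong: if_cong)
  have \<rho>f: "\<rho> (axis i 1) = f i" for i
    by (simp add: \<rho>_def axis_def if_distrib[where f="\<lambda>x. x *\<^sub>R _"] cong: if_cong)
  have \<rho>lC: "\<rho> (l x) = x" if "x \<in> C" for x
  proof -
    from that f obtain i where "x = f i" by (auto simp: bij_betw_def)
    then show ?thesis by (simp add: lf \<rho>f)
  qed
  have lB: "l x = 0" if "x \<in> B" for x
    using that l(2) \<open>B \<subseteq> B'\<close> by (auto simp: C_def)
  have zero: "l x = 0" if "x \<in> h" for x
    using linear_eq_0_on_span[OF l(1) lB] that B(3) by auto
  have "x - \<rho> (l x) \<in> h" for x
  proof -
    let ?P = "\<lambda>x. x - \<rho> (l x)"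
    have "linear ?P"
      using linear_compose_sub[OF linear_id linear_compose[OF l(1) \<rho>]] by (simp add: o_def)
    then have "subspace (?P -` h)"
      using h by (rule linear_subspace_vimage)
    moreover have "?P x \<in> h" if "x \<in> B'" for x
      using \<rho>lC[of x] lB[of x] B(1) that subspace_0[OF h] linear_0[OF \<rho>]
      by (cases "x \<in> C") (auto simp: C_def)
    ultimately have "span B' \<subseteq> ?P -` h"
      by (intro span_minimal) auto
    with B'(3) show ?thesis by auto
  qed
  then have ker: "l x = 0 \<longleftrightarrow> x \<in> h" for x
    using zero by (metis diff_zero linear_0[OF \<rho>])
  have "\<rho> (l c) = c" if "c \<notin> h"
  proof (rule \<rho>lC)
    show "c \<in> C" using that B(1) B'(1) by (auto simp: B1_def C_def)
  qed
  moreover have "matrix l *v x = l x" "matrix \<rho> *v z = \<rho> z" for x z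
    using matrix_works l(1) \<rho> by (auto simp: matrix_works)
  moreover from this have "matrix l ** matrix \<rho> = mat 1"
    by (simp add: matrix_eq matrix_vector_mul_assoc[symmetric] l\<rho>)
  ultimately show ?thesis
    using ker by (intro that[of "matrix l" "matrix \<rho>"]) auto
qed

lemma complexify_simps [simp]:
  "complexify (x + y) = complexify x + complexify y" "complexify (- x) = - complexify x"
  "complexify (c *s x) = complex_of_real c *s complexify x"
  "complexify (axis i 1) = axis i 1" "complexify 0 = 0"
  by (simp_all add: complexify_def vec_eq_iff axis_def)

lemma symp_complexify [simp]: "symp (complexify v) (complexify w) = complex_of_real (symp v w)"
  by (simp add: symp_def complexify_def)

lemma complexify_mult:
  "complexify (v \<otimes>\<^bsub>heisenberg_real\<^esub> w) = complexify v \<otimes>\<^bsub>heisenberg_complex\<^esub> complexify w"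
  by (simp add: heisenberg_mult)

lemma complexify_combination_eq_0_iff:
  "complexify x + \<i> *s complexify y = 0 \<longleftrightarrow> x = 0 \<and> y = 0"
  by (auto simp: complexify_def vec_eq_iff complex_eq_iff)

lemma complexify_cases:
  obtains x y where "v = complexify x + \<i> *s complexify y"
proof
  show "v = complexify (\<chi> i. Re (v $ i)) + \<i> *s complexify (\<chi> i. Im (v $ i))"
    by (simp add: complexify_def vec_eq_iff complex_eq_iff)
qed

text \<open>
  The matrix of the complex-linear extension.
\<close>

definition cmat :: "real^'k^'m \<Rightarrow> complex^'k^'m" where
  "cmat A = (\<chi> i j. complex_of_real (A $ i $ j))"

lemma cmat_complexify [simp]: "cmat A *v complexify x = complexify (A *v x)"
  by (simp add: cmat_def complexify_def matrix_vector_mult_def vec_eq_iff)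

lemma cmat_inverse: "A ** B = mat 1 \<Longrightarrow> cmat A *v (cmat B *v z) = z"
proof -
  assume AB: "A ** B = mat 1"
  obtain x y where z: "z = complexify x + \<i> *s complexify y" by (rule complexify_cases)
  from AB have "A *v (B *v x) = x" for x by (simp add: matrix_vector_mul_assoc)
  then show ?thesis by (simp add: z matrix_vector_right_distrib vector_scalar_commute)
qed

lemma complexify_scaleR [simp]: "complexify (c *\<^sub>R x) = complex_of_real c *s complexify x"
  by (simp add: complexify_def vec_eq_iff)

section \<open>The global chart of the quotient\<close>

text \<open>
  \<open>L\<close> gives linear coordinates on the quotient of the Lie algebra of \<open>G\<close> by that of \<open>H\<close>, and \<open>R\<close> is a
  section of it. The last assumption distinguishes the two shapes of \<open>H\<close>: either \<open>H\<close> contains the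
  centre of \<open>G\<close>, or the section passes through the centre.
\<close>

locale adapted_chart =
  fixes H :: "(real^('n::finite heis_index)) set"
    and L :: "real^('n heis_index)^'m" and R :: "real^'m^('n heis_index)"
  assumes H: "subgroup H heisenberg_real"
    and LR: "L ** R = mat 1"
    and kernel: "L *v x = 0 \<longleftrightarrow> x \<in> lie_algebra_of H"
    and central: "axis IZ 1 \<notin> lie_algebra_of H \<Longrightarrow> R *v (L *v axis IZ 1) = axis IZ 1"
begin

definition proj :: "complex^('n heis_index) \<Rightarrow> complex^'m" where
  "proj v = cmat L *v v"

definition lift :: "complex^'m \<Rightarrow> complex^('n heis_index)" where
  "lift z = cmat R *v z"

text \<open>
  The direction of the centre of the group in the coordinates; it vanishes if and only if \<open>H\<close> contains
  this centre.
\<close>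

definition center :: "complex^'m" where
  "center = proj (axis IZ 1)"

lemma proj_simps [simp]:
    "proj (v + w) = proj v + proj w" "proj (v - w) = proj v - proj w"
    "proj (c *s v) = c *s proj v" "proj (- v) = - proj v" "proj (axis IZ 1) = center"
  and proj_zero [simp]: "proj 0 = 0"
  and proj_complexify [simp]: "proj (complexify x) = complexify (L *v x)"
  and lift_simps [simp]:
    "lift (z + z') = lift z + lift z'" "lift (c *s z) = c *s lift z" "lift 0 = 0"
    "lift (complexify a) = complexify (R *v a)"
  and proj_lift [simp]: "proj (lift z) = z"
  by (simp_all add: proj_def lift_def center_def matrix_vector_right_distrib matrix_vector_mult_diff_distrib
      vector_scalar_commute cmat_inverse[OF LR])
    (metis add.right_inverse add_eq_0_iff matrix_vector_mult_0_right matrix_vector_right_distrib)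

lemma linear_proj: "linear proj" and linear_lift: "linear lift"
  by (auto intro: complex_linear_imp_linear)

lemma complexified_subgroup_eq: "complexified_subgroup H = {v. proj v = 0}"
proof (intro Set.set_eqI iffI)
  fix v assume "v \<in> {v. proj v = 0}"
  moreover obtain x y where v: "v = complexify x + \<i> *s complexify y" by (rule complexify_cases)
  ultimately show "v \<in> complexified_subgroup H"
    by (auto simp: complexify_combination_eq_0_iff kernel complexified_subgroup_def)
qed (auto simp: complexified_subgroup_def kernel[symmetric])

text \<open>
  Otherwise the bracket of \<open>x\<close> and \<open>y\<close> would be a non-zero multiple of \<open>Z\<close>, and \<open>Z\<close> would lie in the Lie
  algebra of \<open>H\<close>.
\<close>

lemma isotropic_real:
  assumes "axis IZ 1 \<notin> lie_algebra_of H" "L *v x = 0" "L *v y = 0"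
  shows "symp x y = 0"
proof (rule ccontr)
  assume "symp x y \<noteq> 0"
  moreover have "symp x y *s axis IZ 1 \<in> lie_algebra_of H"
    using assms(2,3) by (intro lie_algebra_of_bracket[OF H]) (simp_all add: kernel)
  from subspace_scale[OF subspace_lie_algebra_of[OF H] this, of "1 / symp x y"]
  have "(1 / symp x y) *\<^sub>R (symp x y *s axis IZ 1) \<in> lie_algebra_of H" .
  ultimately show False
    using assms(1) by (simp flip: scalar_mult_eq_scaleR)
qed

text \<open>
  Isotropy passes to the complexified Lie algebra by bilinearity. The identities below rest on these facts
  if \<open>center\<close> does not vanish; if it does, they become linear, since it is a factor of all quadratic terms.
\<close>

lemma central_cases:
  assumes "center \<noteq> 0"
  shows "axis IZ 1 \<notin> lie_algebra_of H" and "lift center = axis IZ 1"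
    and "proj v = 0 \<Longrightarrow> proj w = 0 \<Longrightarrow> symp v w = 0"
proof -
  have eq: "center = complexify (L *v axis IZ 1)"
    using proj_complexify[of "axis IZ 1"] by simp
  with assms have "L *v axis IZ 1 \<noteq> 0" by auto
  then show Z: "axis IZ 1 \<notin> lie_algebra_of H" by (simp add: kernel)
  then show "lift center = axis IZ 1" by (simp add: eq central)
  assume *: "proj v = 0" "proj w = 0"
  obtain x y where v: "v = complexify x + \<i> *s complexify y" by (rule complexify_cases)
  obtain x' y' where w: "w = complexify x' + \<i> *s complexify y'" by (rule complexify_cases)
  have "L *v x = 0" "L *v y = 0" "L *v x' = 0" "L *v y' = 0"
    using * by (auto simp: v w complexify_combination_eq_0_iff)
  then show "symp v w = 0"
    using isotropic_real[OF Z] by (simp add: v w)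
qed

text \<open>
  Every \<open>v\<close> is the product of an element \<open>lift z\<close> of the chosen complement and an element of the
  complexified subgroup; \<open>coset_param v\<close> is this \<open>z\<close>. If the subgroup does not contain the centre, right
  multiplication by it changes the linear coordinates \<open>proj v\<close>, because it moves \<open>v\<close> along the centre; the
  quadratic term compensates this.
\<close>

definition coset_param :: "complex^('n heis_index) \<Rightarrow> complex^'m" where
  "coset_param v = proj v + (symp v (lift (proj v)) / 2) *s center"

lemma coset_param_lift: "coset_param (lift z) = z"
  by (simp add: coset_param_def)

lemma symp_kernel:
  assumes "center \<noteq> 0" "proj w = 0"
  shows "symp v w = symp (lift (proj v)) w"
proof -
  have "symp (v - lift (proj v)) w = 0"
    using assms by (intro central_cases(3)) simp_all
  then show ?thesis by simp
qed

text \<open>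
  If \<open>center\<close> does not vanish, right multiplication by \<open>w\<close> adds \<open>symp v w / 2\<close> to the coordinate along the centre; isotropy gives
  \<open>symp v w = symp (lift (proj v)) w\<close>, so the quadratic term changes by the opposite amount.
\<close>

lemma coset_param_mult_kernel:
  assumes "proj w = 0"
  shows "coset_param (v \<otimes>\<^bsub>heisenberg\<^esub> w) = coset_param v"
proof (cases "center = 0")
  case False
  have "coset_param (v \<otimes>\<^bsub>heisenberg\<^esub> w)
      = proj v + (symp v w / 2) *s center + ((symp v (lift (proj v)) + symp w (lift (proj v))) / 2) *s center"
    by (simp add: coset_param_def heisenberg_mult assms central_cases(2)[OF False])
  also have "\<dots> = coset_param v"
    using symp_kernel[OF False assms, of v] symp_swap[of w "lift (proj v)"]
    by (simp add: coset_param_def vec_eq_iff algebra_simps add_divide_distrib diff_divide_distrib)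
  finally show ?thesis .
qed (simp add: coset_param_def heisenberg_mult assms)

text \<open>
  If \<open>center\<close> does not vanish, equality of the parameters forces \<open>v' - v\<close> to be an element \<open>k\<close> of the kernel of \<open>proj\<close> plus a multiple \<open>c\<close>
  of \<open>Z\<close>; comparing the quadratic terms yields \<open>c = symp v k / 2\<close>, which is exactly the correction that the
  product \<open>v k\<close> carries.
\<close>

lemma coset_param_eq_imp_kernel:
  assumes "coset_param v = coset_param v'"
  shows "proj ((- v) \<otimes>\<^bsub>heisenberg\<^esub> v') = 0"
proof (cases "center = 0")
  case True
  with assms show ?thesis by (simp add: coset_param_def heisenberg_mult)
next
  case False
  define c where "c = (symp v (lift (proj v)) - symp v' (lift (proj v'))) / 2"
  define k where "k = v' - v - c *s axis IZ 1"
  have "proj v' = proj v + c *s center"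
    using assms by (simp add: coset_param_def c_def vec_eq_iff algebra_simps diff_divide_distrib)
  then have k: "proj k = 0" by (simp add: k_def)
  have v': "v' = v + k + c *s axis IZ 1" by (simp add: k_def)
  have "symp v' (lift (proj v')) = symp v (lift (proj v)) + symp k (lift (proj v))"
    by (simp add: v' k central_cases(2)[OF False])
  then have "c = symp v k / 2"
    using symp_kernel[OF False k, of v] symp_swap[of k "lift (proj v)"] by (simp add: c_def)
  moreover have "(- v) \<otimes>\<^bsub>heisenberg\<^esub> v' = k + (c - symp v k / 2) *s axis IZ 1"
    by (simp add: heisenberg_mult v' vec_eq_iff algebra_simps)
  ultimately show ?thesis using k by simp
qed

sublocale K: group "heisenberg_complex :: (complex^('n heis_index)) monoid"
  by (rule group_heisenberg)

lemma subgroup_complexified: "subgroup (complexified_subgroup H) heisenberg_complex"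
proof (rule K.subgroupI)
  show "complexified_subgroup H \<noteq> {}"
    unfolding complexified_subgroup_eq using proj_zero by blast
  fix v w assume "v \<in> complexified_subgroup H" "w \<in> complexified_subgroup H"
  then show "v \<otimes>\<^bsub>heisenberg\<^esub> w \<in> complexified_subgroup H"
    using central_cases(3)[of v w]
    by (cases "center = 0") (auto simp: complexified_subgroup_eq heisenberg_mult)
qed (auto simp: complexified_subgroup_eq heisenberg_inv)

lemma coset_param_eq_iff:
  "coset_param v = coset_param v' \<longleftrightarrow>
    v <#\<^bsub>heisenberg\<^esub> complexified_subgroup H = v' <#\<^bsub>heisenberg\<^esub> complexified_subgroup H"
proof
  assume "coset_param v = coset_param v'"
  then have "(- v) \<otimes>\<^bsub>heisenberg\<^esub> v' \<in> complexified_subgroup H"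
    by (simp add: coset_param_eq_imp_kernel complexified_subgroup_eq)
  moreover have "v \<otimes>\<^bsub>heisenberg\<^esub> ((- v) \<otimes>\<^bsub>heisenberg\<^esub> v') = v'"
    by (simp add: heisenberg_mult)
  ultimately have "v' \<in> v <#\<^bsub>heisenberg\<^esub> complexified_subgroup H"
    unfolding l_coset_def by force
  then show "v <#\<^bsub>heisenberg\<^esub> complexified_subgroup H = v' <#\<^bsub>heisenberg\<^esub> complexified_subgroup H"
    by (rule K.l_repr_independence) (simp_all add: subgroup_complexified)
next
  assume "v <#\<^bsub>heisenberg\<^esub> complexified_subgroup H = v' <#\<^bsub>heisenberg\<^esub> complexified_subgroup H"
  moreover have "v' \<in> v' <#\<^bsub>heisenberg\<^esub> complexified_subgroup H"
    by (rule K.lcos_self) (simp_all add: subgroup_complexified)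
  ultimately have "v' \<in> v <#\<^bsub>heisenberg\<^esub> complexified_subgroup H"
    by blast
  then obtain w where "w \<in> complexified_subgroup H" "v' = v \<otimes>\<^bsub>heisenberg\<^esub> w"
    unfolding l_coset_def by auto
  then show "coset_param v = coset_param v'"
    by (simp add: coset_param_mult_kernel complexified_subgroup_eq)
qed

lemma holomorphic_coset_param: "holomorphic_vec coset_param UNIV"
proof -
  let ?B = "\<lambda>v w. (symp v (lift (proj w)) / 2) *s center"
  have "linear (\<lambda>v. ?B v w)" "linear (\<lambda>w. ?B v w)" for v w
    by (rule complex_linear_imp_linear; simp add: vec_eq_iff add_divide_distrib algebra_simps)+
  then have "bilinear ?B" unfolding bilinear_def by blast
  then have "holomorphic_vec (\<lambda>v. 0 + proj v + ?B v v) UNIV"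
    by (intro holomorphic_vec_quadratic linear_proj) auto
  then show ?thesis by (simp add: coset_param_def[abs_def])
qed

sublocale global_coset_chart heisenberg_complex "complexified_subgroup H" coset_param lift
proof
  show "holomorphic_vec lift UNIV"
    using holomorphic_vec_affine[OF linear_lift, of 0] by simp
qed (simp_all add: coset_param_eq_iff coset_param_lift holomorphic_coset_param)

section \<open>The action in coordinates\<close>

text \<open>
  The action of the real group in the global coordinates.
\<close>

definition move :: "real^('n heis_index) \<Rightarrow> complex^'m \<Rightarrow> complex^'m" where
  "move g z = coset_param (complexify g \<otimes>\<^bsub>heisenberg\<^esub> lift z)"

lemma left_translation_coset:
  "left_translation H g (v <#\<^bsub>heisenberg\<^esub> complexified_subgroup H)
    = (complexify g \<otimes>\<^bsub>heisenberg\<^esub> v) <#\<^bsub>heisenberg\<^esub> complexified_subgroup H"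
proof -
  have "v <#\<^bsub>heisenberg\<^esub> complexified_subgroup H \<in> lcosets\<^bsub>heisenberg\<^esub> (complexified_subgroup H)"
    by (auto simp: LCOSETS_def)
  then show ?thesis
    by (simp add: left_translation_def K.lcos_m_assoc)
qed

lemma left_translation_point: "left_translation H g (point z) = point (move g z)"
  unfolding move_def coset_eq_point[symmetric] left_translation_coset[symmetric] by (simp add: point_def)

lemma left_translation_mult:
  "left_translation H (g \<otimes>\<^bsub>heisenberg_real\<^esub> g') (point z)
    = left_translation H g (left_translation H g' (point z))"
  by (simp add: point_def left_translation_coset complexify_mult K.m_assoc)

lemma move_mult: "move (g \<otimes>\<^bsub>heisenberg_real\<^esub> g') z = move g (move g' z)"
  using left_translation_mult by (simp add: left_translation_point)

lemma move_zero: "move 0 z = z"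
  by (simp add: move_def heisenberg_mult coset_param_lift)

text \<open>
  Up to a complex multiple of \<open>center\<close>, a group element acts by the real translation \<open>L g\<close>. For an
  element of the Lie algebra of \<open>H\<close> this translation is trivial, and only the term \<open>symp g (lift z)\<close> remains.
\<close>

lemma move_eq:
  "move g z = z + complexify (L *v g) +
     (symp (complexify g) (lift z) + symp (complexify g) (complexify (R *v (L *v g))) / 2
       + symp (lift z) (complexify (R *v (L *v g))) / 2) *s center"
proof (cases "center = 0")
  case False
  have "symp (lift z) (lift z) = 0" by simp
  then show ?thesis
    by (simp add: move_def coset_param_def heisenberg_mult central_cases(2)[OF False] vec_eq_iff algebra_simps
        add_divide_distrib)
qed (simp add: move_def coset_param_def heisenberg_mult)

lemma group_action_left_translation:
  "group_action heisenberg_real (topspace (top_of space)) (left_translation H)"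
proof -
  let ?E = "topspace (top_of space)"
  have maps: "left_translation H g x \<in> ?E" if "x \<in> ?E" for g x
    using that unfolding topspace_space by (auto simp: left_translation_point)
  have inverse: "left_translation H (- g) (left_translation H g x) = x" if "x \<in> ?E" for g x
  proof -
    have "(- g) \<otimes>\<^bsub>heisenberg_real\<^esub> g = 0" by (simp add: heisenberg_mult)
    then show ?thesis
      using that unfolding topspace_space
      by (auto simp: left_translation_point move_zero simp flip: move_mult)
  qed
  have "bij_betw (left_translation H g) ?E ?E" for g
    using maps inverse[of _ g] inverse[of _ "- g"]
    by (intro bij_betw_byWitness[where f'="left_translation H (- g)"]) auto
  moreover have "left_translation H g \<in> extensional ?E" for g
    unfolding topspace_space lcosets_eq[symmetric] by (simp add: left_translation_def)
  ultimately have Bij: "left_translation H g \<in> Bij ?E" for g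
    by (simp add: Bij_def)
  have "left_translation H (g \<otimes>\<^bsub>heisenberg_real\<^esub> g') = compose ?E (left_translation H g) (left_translation H g')" for g g'
  proof (rule extensionalityI[of _ ?E])
    show "left_translation H (g \<otimes>\<^bsub>heisenberg_real\<^esub> g') \<in> extensional ?E"
      using Bij by (simp add: Bij_def)
    fix x assume "x \<in> ?E"
    then show "left_translation H (g \<otimes>\<^bsub>heisenberg_real\<^esub> g') x
        = compose ?E (left_translation H g) (left_translation H g') x"
      unfolding topspace_space by (auto simp: compose_def left_translation_mult)
  qed (rule compose_extensional)
  then have "left_translation H \<in> hom heisenberg_real (BijGroup ?E)"
    using Bij by (auto simp: hom_def BijGroup_def)
  then show ?thesis
    by (simp add: group_action_def group_hom_def group_hom_axioms_def group_heisenberg group_BijGroup)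
qed

lemma smooth_move: "smooth (\<lambda>(g, z). move g z) UNIV"
proof -
  let ?A = "\<lambda>q :: (real^('n heis_index)) \<times> (complex^'m). snd q + complexify (L *v fst q)"
  let ?B = "\<lambda>q q' :: (real^('n heis_index)) \<times> (complex^'m).
    (symp (complexify (fst q)) (lift (snd q')) + symp (complexify (fst q)) (complexify (R *v (L *v fst q'))) / 2
       + symp (lift (snd q)) (complexify (R *v (L *v fst q'))) / 2) *s center"
  note simps = matrix_vector_right_distrib matrix_vector_mult_scaleR scaleR_eq_of_real_scalar_mult
    vec_eq_iff add_divide_distrib
  have "linear ?A"
    by (rule linearI) (simp_all add: simps algebra_simps)
  moreover have "linear (\<lambda>q. ?B q q')" "linear (\<lambda>q'. ?B q q')" for q q'
    by (rule linearI; simp add: simps del: symp_complexify; simp add: algebra_simps del: symp_complexify)+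
  then have "bilinear ?B" unfolding bilinear_def by blast
  ultimately have "smooth (\<lambda>q. 0 + ?A q + ?B q q) UNIV"
    by (rule smooth_quadratic)
  then show ?thesis
    by (simp add: move_eq case_prod_unfold)
qed

lemma holomorphic_move: "holomorphic_vec (move g) UNIV"
proof -
  let ?A = "\<lambda>z. z + (symp (complexify g) (lift z) + symp (lift z) (complexify (R *v (L *v g))) / 2) *s center"
  let ?c = "complexify (L *v g) + (symp (complexify g) (complexify (R *v (L *v g))) / 2) *s center"
  have A: "?A (z + w) = ?A z + ?A w" "?A (c *s z) = c *s ?A z" for z w c
    by (simp_all add: vec_eq_iff add_divide_distrib algebra_simps)
  have "holomorphic_vec (\<lambda>z. ?c + ?A z) UNIV"
    by (rule holomorphic_vec_affine[OF complex_linear_imp_linear]) (rule A)+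
  moreover have "(\<lambda>z. ?c + ?A z) = move g"
    by (rule ext) (simp add: move_eq vec_eq_iff algebra_simps)
  ultimately show ?thesis by simp
qed

section \<open>Orbits, slice and reflection\<close>

text \<open>
  In coordinates, every orbit is contained in a leaf, and the orbits of generic points are leaves.
\<close>

definition leaf :: "complex^'m \<Rightarrow> (complex^'m) set" where
  "leaf z = {z + complexify a + \<mu> *s center | a \<mu>. True}"

lemma leafI: "z + complexify a + \<mu> *s center \<in> leaf z"
  by (auto simp: leaf_def)

lemma leaf_sym: "w \<in> leaf z \<Longrightarrow> z \<in> leaf w"
proof -
  assume "w \<in> leaf z"
  then obtain a \<mu> where w: "w = z + complexify a + \<mu> *s center"
    by (auto simp: leaf_def)
  have "w + complexify (- a) + (- \<mu>) *s center = z"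
    by (simp add: w vec_eq_iff)
  then show ?thesis using leafI[of w "- a" "- \<mu>"] by simp
qed

lemma leaf_trans:
  assumes "w \<in> leaf z" "u \<in> leaf w" shows "u \<in> leaf z"
proof -
  from assms obtain a \<mu> b \<nu> where "w = z + complexify a + \<mu> *s center"
      "u = w + complexify b + \<nu> *s center"
    by (auto simp: leaf_def)
  then have "u = z + complexify (a + b) + (\<mu> + \<nu>) *s center"
    by (simp add: vec_eq_iff algebra_simps)
  then show ?thesis by (simp only: leafI)
qed

lemma move_in_leaf: "move g z \<in> leaf z"
  unfolding move_eq by (rule leafI)

text \<open>
  For \<open>g\<close> in the Lie algebra of \<open>H\<close>, the points whose imaginary part \<open>g\<close> moves along \<open>center\<close>, if that
  direction is present at all.
\<close>

definition generic :: "real^('n heis_index) \<Rightarrow> (complex^'m) set" where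
  "generic g = {z. center = 0 \<or> Im (symp (complexify g) (lift z)) \<noteq> 0}"

text \<open>
  Within a leaf, \<open>symp g (lift z)\<close> only changes by real numbers \<open>symp g (R a)\<close>, as \<open>center\<close> lifts to \<open>Z\<close>.
\<close>

lemma leaf_generic:
  assumes "z \<in> generic g" "w \<in> leaf z" shows "w \<in> generic g"
proof (cases "center = 0")
  case False
  with assms show ?thesis
    by (auto simp: generic_def leaf_def central_cases(2)[OF False])
qed (simp add: generic_def)

text \<open>
  If \<open>center\<close> does not vanish, the element \<open>g\<close> is essential: the centre of the real group moves points by
  real multiples of \<open>center\<close> only, while \<open>exp (s g)\<close> moves a generic point \<open>z\<close> by the multiple
  \<open>s * symp g (lift z)\<close>, which is not real for \<open>s \<noteq> 0\<close>. Together they reach every complex multiple.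
\<close>

lemma orbit_generic:
  assumes g: "g \<in> lie_algebra_of H" and z: "z \<in> generic g"
  shows "range (\<lambda>g. move g z) = leaf z"
proof
  show "leaf z \<subseteq> range (\<lambda>g. move g z)"
  proof
    fix w assume "w \<in> leaf z"
    then obtain a \<mu> where w: "w = z + complexify a + \<mu> *s center"
      by (auto simp: leaf_def)
    have LRa: "L *v (R *v a) = a" by (simp add: matrix_vector_mul_assoc LR)
    show "w \<in> range (\<lambda>g. move g z)"
    proof (cases "center = 0")
      case True
      then have "w = move (R *v a) z" by (simp add: w move_eq LRa)
      then show ?thesis by blast
    next
      case False
      \<comment> \<open>The element \<open>R a\<close> achieves the real translation by \<open>a\<close>, at the price of an uncontrolled multiple
        of \<open>center\<close>. This multiple is then corrected by \<open>s g + c Z\<close>.\<close>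
      define u where "u = move (R *v a) z"
      obtain \<mu>' where u: "u = z + complexify a + \<mu>' *s center"
        unfolding u_def move_eq LRa by blast
      define \<omega> where "\<omega> = symp (complexify g) (lift u)"
      have "u \<in> generic g"
        unfolding u_def using leaf_generic[OF z move_in_leaf] .
      then have \<omega>: "Im \<omega> \<noteq> 0" using False by (simp add: generic_def \<omega>_def)
      define s where "s = Im (\<mu> - \<mu>') / Im \<omega>"
      define c where "c = Re (\<mu> - \<mu>') - s * Re \<omega>"
      have sc: "complex_of_real s * \<omega> + complex_of_real c = \<mu> - \<mu>'"
        using \<omega> by (simp add: complex_eq_iff s_def c_def)
      define g' where "g' = s *s g + c *s axis IZ 1"
      have Lg: "L *v g = 0" using g by (simp add: kernel)
      have Z: "R *v (L *v axis IZ 1) = axis IZ 1"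
        using central_cases(1)[OF False] by (rule central)
      have "complexify (L *v axis IZ 1) = center"
        using proj_complexify[of "axis IZ 1"] by simp
      then have Lg': "complexify (L *v g') = complex_of_real c *s center"
        by (simp add: g'_def matrix_vector_right_distrib vector_scalar_commute Lg del: scalar_mult_eq_scaleR)
      have RLg': "R *v (L *v g') = c *s axis IZ 1"
        by (simp add: g'_def matrix_vector_right_distrib vector_scalar_commute Lg Z del: scalar_mult_eq_scaleR)
      have "symp (complexify g') (lift u) = complex_of_real s * \<omega>"
        by (simp add: g'_def \<omega>_def del: scalar_mult_eq_scaleR)
      then have "move g' u = u + (complex_of_real s * \<omega> + complex_of_real c) *s center"
        unfolding move_eq Lg' RLg' by (simp add: vec_eq_iff algebra_simps)
      also have "\<dots> = w"
        unfolding sc by (simp add: w u vec_eq_iff algebra_simps)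
      finally have "w = move (g' \<otimes>\<^bsub>heisenberg_real\<^esub> (R *v a)) z"
        by (simp add: move_mult u_def)
      then show ?thesis by blast
    qed
  qed
qed (auto intro: move_in_leaf)

lemma open_generic: "open (generic g)"
proof (cases "center = 0")
  case False
  have "linear (\<lambda>z. Im (symp (complexify g) (lift z)))"
    by (rule linearI) (simp_all add: scaleR_eq_of_real_scalar_mult)
  then have "continuous_on UNIV (\<lambda>z. Im (symp (complexify g) (lift z)))"
    by (simp add: linear_continuous_on linear_conv_bounded_linear)
  then have "open {z. Im (symp (complexify g) (lift z)) \<noteq> 0}"
    by (intro open_Collect_neq continuous_on_const)
  with False show ?thesis by (simp add: generic_def)
qed (simp add: generic_def)

text \<open>
  If \<open>Z\<close> is not in the Lie algebra of \<open>H\<close>, then \<open>g\<close> is not central and pairs non-trivially with some \<open>v\<close>.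
  By isotropy, the part of \<open>v\<close> in that Lie algebra is orthogonal to \<open>g\<close>, so the class of \<open>v\<close> in the quotient, multiplied by
  \<open>\<i>\<close>, is a generic point.
\<close>

lemma generic_nonempty:
  assumes g: "g \<in> lie_algebra_of H" "g \<noteq> 0"
  shows "generic g \<noteq> {}"
proof (cases "center = 0")
  case False
  note Z = central_cases(1)[OF False]
  have "\<exists>v. symp g v \<noteq> 0"
  proof (rule ccontr)
    assume "\<not> ?thesis"
    then have eq: "g = (g $ IZ) *s axis IZ 1" using symp_nondegenerate by blast
    with g(2) have "g $ IZ \<noteq> 0" by auto
    then have "axis IZ 1 = (1 / g $ IZ) *\<^sub>R g"
      by (subst eq) (simp flip: scalar_mult_eq_scaleR)
    then show False
      using Z subspace_scale[OF subspace_lie_algebra_of[OF H] g(1)] by metis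
  qed
  then obtain v where v: "symp g v \<noteq> 0" by blast
  let ?z = "\<i> *s complexify (L *v v)"
  have "L *v (v + (-1) *s (R *v (L *v v))) = 0"
    by (simp only: matrix_vector_right_distrib vector_scalar_commute matrix_vector_mul_assoc matrix_mul_assoc LR)
      (simp add: vec_eq_iff)
  then have "symp g (v + (-1) *s (R *v (L *v v))) = 0"
    using g(1) by (intro isotropic_real[OF Z]) (simp_all add: kernel)
  then have "symp g (R *v (L *v v)) = symp g v"
    by simp
  then have "?z \<in> generic g"
    using v by (simp add: generic_def)
  then show ?thesis by blast
qed (simp add: generic_def)

text \<open>
  The reflection \<open>z \<mapsto> - cnj z\<close> keeps the imaginary part, whereas complex conjugation would reverse it
  and so exchange orbits in general.
\<close>

definition reflect :: "complex^'m \<Rightarrow> complex^'m" where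
  "reflect z = (\<chi> i. - cnj (z $ i))"

lemma reflect_reflect [simp]: "reflect (reflect z) = z"
  by (simp add: reflect_def vec_eq_iff)

lemma linear_reflect: "linear reflect"
  by (rule linearI) (simp_all add: reflect_def vec_eq_iff)

text \<open>
  The point moves by twice its real part, a real translation.
\<close>

lemma reflect_in_leaf: "reflect z \<in> leaf z"
proof -
  have "reflect z = z + complexify (\<chi> i. - 2 * Re (z $ i)) + 0 *s center"
    by (simp add: reflect_def complexify_def vec_eq_iff complex_eq_iff)
  then show ?thesis using leafI by metis
qed

text \<open>
  The fixed points are the purely imaginary vectors; removing the real part is a real translation.
\<close>

lemma leaf_meets_fixed_points: "\<exists>w\<in>leaf z. reflect w = w"
proof
  show "z + complexify (\<chi> i. - Re (z $ i)) + 0 *s center \<in> leaf z" by (rule leafI)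
  show "reflect (z + complexify (\<chi> i. - Re (z $ i)) + 0 *s center)
      = z + complexify (\<chi> i. - Re (z $ i)) + 0 *s center"
    by (simp add: reflect_def complexify_def vec_eq_iff complex_eq_iff)
qed

lemma reflect_leaf: "reflect ` leaf z = leaf z"
proof -
  have "reflect w \<in> leaf z" if "w \<in> leaf z" for w
    using that reflect_in_leaf leaf_trans by blast
  then show ?thesis
    by (metis (no_types, lifting) image_subsetI reflect_reflect rev_image_eqI subsetI subset_antisym)
qed

definition conjugation :: "(complex^('n heis_index)) set \<Rightarrow> (complex^('n heis_index)) set" where
  "conjugation x = point (reflect (coord x))"

lemma conjugation_point [simp]: "conjugation (point z) = point (reflect z)"
  by (simp add: conjugation_def)

lemma antiholomorphic_diffeo_conjugation: "antiholomorphic_diffeo space conjugation"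
proof -
  have bij: "bij_betw conjugation (range point) (range point)"
    by (rule bij_betw_byWitness[where f'=conjugation]) auto
  have "antiholomorphic_vec reflect UNIV"
    by (rule antiholomorphic_vec_linear[OF linear_reflect]) (simp add: reflect_def vec_eq_iff)
  moreover have "inv_into (range point) conjugation (point z) = point (reflect z)" for z
    using bij by (intro inv_into_f_eq) (auto simp: bij_betw_def)
  ultimately show ?thesis
    unfolding antiholomorphic_diffeo_def topspace_space using bij
    by (auto intro!: manifold_map_space[of _ reflect])
qed

lemma holomorphic_action_left_translation:
  "holomorphic_action heisenberg_real model_manifold space (left_translation H)"
  unfolding holomorphic_action_def
proof (intro conjI ballI)
  show "manifold_map smooth (prod_manifold model_manifold space) space (\<lambda>(g, x). left_translation H g x)"
    using manifold_map_prod_space[where F="\<lambda>(g, z). move g z" and P=smooth, OF smooth_move]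
    by (simp add: left_translation_point)
  show "manifold_map holomorphic_vec space space (left_translation H g)" for g
    by (rule manifold_map_space[where F="move g" and P=holomorphic_vec, OF holomorphic_move left_translation_point])
qed (fact lie_group_heisenberg complex_manifold_space group_action_left_translation)+

lemma orbit_point: "orbit heisenberg_real (left_translation H) (point z) = point ` range (\<lambda>g. move g z)"
  by (auto simp: orbit_def left_translation_point)

text \<open>
  The slice consists of the purely imaginary generic points. Its leaves, which are orbits, fill the set of
  generic points, and the reflection preserves each leaf.
\<close>

lemma strongly_visible_left_translation:
  assumes g: "g \<in> lie_algebra_of H" "g \<noteq> 0"
  shows "strongly_visible heisenberg_real model_manifold space (left_translation H)"
proof -
  let ?T = "{z. reflect z = z}"
  let ?S = "point ` (?T \<inter> generic g)"
  have orbit: "orbit heisenberg_real (left_translation H) (point z) = point ` leaf z"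
    if "z \<in> generic g" for z
    unfolding orbit_point orbit_generic[OF g(1) that] ..
  have "subspace ?T"
    using linear_reflect by (auto simp: subspace_def linear_add linear_scale linear_0)
  then have S: "real_submanifold space ?S"
    using open_generic by (rule real_submanifold_space)
  let ?D = "\<Union>s\<in>?S. orbit heisenberg_real (left_translation H) s"
  have D: "?D = point ` generic g"
  proof -
    have "?D = point ` (\<Union>z\<in>?T \<inter> generic g. leaf z)"
      using orbit by auto
    also have "(\<Union>z\<in>?T \<inter> generic g. leaf z) = generic g"
      using leaf_meets_fixed_points leaf_generic leaf_sym by blast
    finally show ?thesis .
  qed
  have preserves: "conjugation ` orbit heisenberg_real (left_translation H) x
      = orbit heisenberg_real (left_translation H) x" if "x \<in> point ` generic g" for x
  proof -
    from that obtain z where z: "z \<in> generic g" "x = point z" by blast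
    have "conjugation ` point ` leaf z = point ` reflect ` leaf z"
      by (simp add: image_image)
    then show ?thesis by (simp add: z orbit reflect_leaf)
  qed
  have "?D \<noteq> {}" "openin (top_of space) ?D"
    unfolding D using generic_nonempty[OF g] openin_point_image[OF open_generic] by auto
  moreover have "\<forall>s\<in>?S. conjugation s = s"
    by auto
  moreover have "\<forall>x\<in>?D. conjugation ` orbit heisenberg_real (left_translation H) x
      = orbit heisenberg_real (left_translation H) x"
    unfolding D using preserves by blast
  ultimately show ?thesis
    unfolding strongly_visible_def Let_def
    by (intro conjI exI[of _ ?S] exI[of _ conjugation] S holomorphic_action_left_translation
        connected_space_space antiholomorphic_diffeo_conjugation)
qed

end

theorem corollary1p2:
  fixes H :: "(real^('n::finite heis_index)) set"
  assumes "subgroup H heisenberg_real"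
    and "closed H" and "connected H"
    and "H \<noteq> {\<one>\<^bsub>heisenberg_real\<^esub>}" and "H \<noteq> carrier heisenberg_real"
    and dim_quotient: "CARD('m::finite) + dim (lie_algebra_of H) = 2 * CARD('n) + 1"
  shows "strongly_visible heisenberg_real model_manifold
    (homogeneous_space heisenberg_complex (complexified_subgroup H)
       :: ((complex^('n heis_index)) set, complex^'m) charted_space)
    (left_translation H)"
proof -
  obtain g where g: "g \<in> lie_algebra_of H" "g \<noteq> 0"
    using lie_algebra_of_nontrivial[OF assms(1-3)] assms(4) by auto
  have "CARD('m) + dim (lie_algebra_of H) = CARD('n heis_index)"
    using dim_quotient by (simp add: card_heis_index)
  then obtain L :: "real^('n heis_index)^'m" and R :: "real^'m^('n heis_index)" where
    LR: "L ** R = mat 1" "\<And>x. L *v x = 0 \<longleftrightarrow> x \<in> lie_algebra_of H"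
      "axis IZ 1 \<notin> lie_algebra_of H \<Longrightarrow> R *v (L *v axis IZ 1) = axis IZ 1"
    using adapted_coordinates[OF subspace_lie_algebra_of[OF assms(1)], where ?'m='m and c="axis IZ 1"]
    by blast
  interpret adapted_chart H L R
    by (rule adapted_chart.intro[OF assms(1) LR])
  show ?thesis
    using g by (rule strongly_visible_left_translation)
qed

end
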